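(* There exists a quasiisometric embedding of the hyperbolic plane $\mathbb{H}^2$ into the product $T\times T$ of two binary trees.
   Context: The binary tree $T$ is the rooted tree whose vertices are the finite sequences (including the empty one, the root) with entries in $\{0,1\}$, two vertices being joined by an edge iff one is obtained from the other by erasing the last term; all edges have length 1. Products of trees carry the $l_1$-product metric (distance is the sum of the distances in the factors). *)

theory Defs
  imports "HOL-Analysis.Analysis"
begin

section \<open>Quasiisometric embeddings\<close>

definition quasiisometric_embedding :: "'a metric \<Rightarrow> 'b metric \<Rightarrow> ('a \<Rightarrow> 'b) \<Rightarrow> bool" where
  "quasiisometric_embedding m1 m2 f \<longleftrightarrow>
     f \<in> mspace m1 \<rightarrow> mspace m2 \<and>
     (\<exists>a b. 1 \<le> a \<and> 0 \<le> b \<and>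
        (\<forall>x\<in>mspace m1. \<forall>y\<in>mspace m1.
           mdist m1 x y / a - b \<le> mdist m2 (f x) (f y) \<and>
           mdist m2 (f x) (f y) \<le> a * mdist m1 x y + b))"


section \<open>The l1-product of metric spaces\<close>

text \<open>The library's \<^const>\<open>prod_metric\<close> is the l2-product.\<close>

definition l1_prod_metric :: "'a metric \<Rightarrow> 'b metric \<Rightarrow> ('a \<times> 'b) metric" where
  "l1_prod_metric m1 m2 =
     metric (mspace m1 \<times> mspace m2,
             \<lambda>p q. mdist m1 (fst p) (fst q) + mdist m2 (snd p) (snd q))"

lemma Metric_space_l1_prod:
  "Metric_space (mspace m1 \<times> mspace m2)
     (\<lambda>p q. mdist m1 (fst p) (fst q) + mdist m2 (snd p) (snd q))"
proof
  fix p q :: "'a \<times> 'b"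
  show "0 \<le> mdist m1 (fst p) (fst q) + mdist m2 (snd p) (snd q)"
    by simp
  show "mdist m1 (fst p) (fst q) + mdist m2 (snd p) (snd q) =
        mdist m1 (fst q) (fst p) + mdist m2 (snd q) (snd p)"
    by (simp add: mdist_commute)
next
  fix p q
  assume "p \<in> mspace m1 \<times> mspace m2" "q \<in> mspace m1 \<times> mspace m2"
  then show "mdist m1 (fst p) (fst q) + mdist m2 (snd p) (snd q) = 0 \<longleftrightarrow> p = q"
    by (auto simp: add_nonneg_eq_0_iff)
next
  fix p q r
  assume "p \<in> mspace m1 \<times> mspace m2" "q \<in> mspace m1 \<times> mspace m2"
    "r \<in> mspace m1 \<times> mspace m2"
  then have "mdist m1 (fst p) (fst r) \<le> mdist m1 (fst p) (fst q) + mdist m1 (fst q) (fst r)"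
    "mdist m2 (snd p) (snd r) \<le> mdist m2 (snd p) (snd q) + mdist m2 (snd q) (snd r)"
    by (auto intro!: mdist_triangle)
  then show "mdist m1 (fst p) (fst r) + mdist m2 (snd p) (snd r) \<le>
      mdist m1 (fst p) (fst q) + mdist m2 (snd p) (snd q) +
      (mdist m1 (fst q) (fst r) + mdist m2 (snd q) (snd r))"
    by linarith
qed

lemma mspace_l1_prod_metric [simp]:
  "mspace (l1_prod_metric m1 m2) = mspace m1 \<times> mspace m2"
  unfolding l1_prod_metric_def by (rule Metric_space.mspace_metric[OF Metric_space_l1_prod])

lemma mdist_l1_prod_metric [simp]:
  "mdist (l1_prod_metric m1 m2) p q = mdist m1 (fst p) (fst q) + mdist m2 (snd p) (snd q)"
  unfolding l1_prod_metric_def by (simp add: Metric_space.mdist_metric[OF Metric_space_l1_prod])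


section \<open>The hyperbolic plane\<close>

text \<open>
  The upper half-plane model, with the metric of constant curvature \<open>-1\<close>.
\<close>

definition upper_half_plane :: "complex set" where
  "upper_half_plane = {z. 0 < Im z}"

definition hyp_dist :: "complex \<Rightarrow> complex \<Rightarrow> real" where
  "hyp_dist z w = arcosh (1 + (cmod (z - w))\<^sup>2 / (2 * Im z * Im w))"

text \<open>
  Distances are set to \<open>0\<close> off the carrier, here and for the tree below, because the locale
  \<^locale>\<open>Metric_space\<close> requires symmetry and nonnegativity on the whole type.
\<close>

definition hyperbolic_plane :: "complex metric" where
  "hyperbolic_plane =
     metric (upper_half_plane,
             \<lambda>z w. if z \<in> upper_half_plane \<and> w \<in> upper_half_plane then hyp_dist z w else 0)"

lemma hyp_dist_arsinh:
  assumes "0 < Im z" "0 < Im w"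
  shows "hyp_dist z w = 2 * arsinh (cmod (z - w) / (2 * sqrt (Im z * Im w)))"
proof -
  let ?q = "cmod (z - w) / (2 * sqrt (Im z * Im w))"
  have "?q\<^sup>2 = (cmod (z - w))\<^sup>2 / (4 * (Im z * Im w))"
    using assms by (simp add: power_divide power_mult_distrib)
  then have "1 + (cmod (z - w))\<^sup>2 / (2 * Im z * Im w) = 1 + 2 * ?q\<^sup>2"
    by simp
  also have "\<dots> = cosh (2 * arsinh ?q)"
    by (subst cosh_double) (simp add: cosh_square_eq)
  finally have "hyp_dist z w = arcosh (cosh (2 * arsinh ?q))"
    by (simp only: hyp_dist_def)
  moreover have "0 \<le> arsinh ?q"
    using arsinh_less_iff_real[of ?q 0] assms by (simp add: not_less[symmetric] divide_less_0_iff mult_less_0_iff)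
  ultimately show ?thesis
    by (simp add: arcosh_cosh_real)
qed

lemma hyp_dist_triangle:
  assumes z: "0 < Im z" and v: "0 < Im v" and w: "0 < Im w"
  shows "hyp_dist z w \<le> hyp_dist z v + hyp_dist v w"
proof -
  define q where "q = (\<lambda>z w. cmod (z - w) / (2 * sqrt (Im z * Im w)))"
  have cosh_q: "cosh (arsinh (q z w)) = cmod (z - cnj w) / (2 * sqrt (Im z * Im w))"
    if "0 < Im z" "0 < Im w" for z w
  proof -
    have "(cmod (z - cnj w))\<^sup>2 = 4 * (Im z * Im w) + (cmod (z - w))\<^sup>2"
      unfolding cmod_power2 by (simp add: power2_eq_square algebra_simps)
    then have "(cosh (arsinh (q z w)))\<^sup>2 = (cmod (z - cnj w) / (2 * sqrt (Im z * Im w)))\<^sup>2"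
      using that
      by (simp add: cosh_square_eq q_def power_divide power_mult_distrib add_divide_distrib)
    then show ?thesis
      using that by (simp add: power2_eq_iff_nonneg)
  qed
  have "(z - w) * (v - cnj v) = (z - cnj v) * (v - w) + (z - v) * (w - cnj v)"
    by (simp add: algebra_simps)
  then have "cmod (z - w) * cmod (v - cnj v) \<le>
      cmod (z - cnj v) * cmod (v - w) + cmod (z - v) * cmod (w - cnj v)"
    by (metis norm_mult norm_triangle_ineq)
  moreover have "cmod (v - cnj v) = 2 * Im v"
    using v by (simp add: cmod_def real_sqrt_mult)
  moreover have "cmod (w - cnj v) = cmod (v - cnj w)"
    by (metis complex_cnj_cnj complex_cnj_diff complex_mod_cnj norm_minus_commute)
  ultimately have ptolemy: "cmod (z - w) * (2 * Im v) \<le>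
      cmod (z - v) * cmod (v - cnj w) + cmod (z - cnj v) * cmod (v - w)"
    by (simp add: algebra_simps)
  define D where "D = 4 * (sqrt (Im z) * sqrt (Im w)) * Im v"
  have D: "D = (2 * sqrt (Im z * Im v)) * (2 * sqrt (Im v * Im w))" "0 < D"
    using z v w by (simp_all add: D_def real_sqrt_mult)
  have "q z w = cmod (z - w) * (2 * Im v) / D"
    using z v w by (simp add: q_def D_def real_sqrt_mult)
  also have "\<dots> \<le> (cmod (z - v) * cmod (v - cnj w) + cmod (z - cnj v) * cmod (v - w)) / D"
    using ptolemy D(2) by (simp add: divide_right_mono)
  also have "\<dots> = q z v * cosh (arsinh (q v w)) + cosh (arsinh (q z v)) * q v w"
    unfolding cosh_q[OF z v] cosh_q[OF v w] unfolding q_def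
    by (simp add: D(1) add_divide_distrib)
  also have "\<dots> = sinh (arsinh (q z v) + arsinh (q v w))"
    by (simp add: sinh_add)
  finally have "arsinh (q z w) \<le> arsinh (q z v) + arsinh (q v w)"
    by (metis arsinh_sinh_real arsinh_less_iff_real linorder_not_le)
  then show ?thesis
    using z v w by (simp add: hyp_dist_arsinh q_def)
qed

lemma Metric_space_hyperbolic_plane:
  "Metric_space upper_half_plane
     (\<lambda>z w. if z \<in> upper_half_plane \<and> w \<in> upper_half_plane then hyp_dist z w else 0)"
proof
  fix z w :: complex
  show "0 \<le> (if z \<in> upper_half_plane \<and> w \<in> upper_half_plane then hyp_dist z w else 0)"
    by (simp add: hyp_dist_def upper_half_plane_def)
  show "(if z \<in> upper_half_plane \<and> w \<in> upper_half_plane then hyp_dist z w else 0) =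
        (if w \<in> upper_half_plane \<and> z \<in> upper_half_plane then hyp_dist w z else 0)"
    by (simp add: hyp_dist_def norm_minus_commute mult.assoc mult.left_commute mult.commute)
next
  fix z w
  assume "z \<in> upper_half_plane" "w \<in> upper_half_plane"
  then show "((if z \<in> upper_half_plane \<and> w \<in> upper_half_plane then hyp_dist z w else 0) = 0)
      \<longleftrightarrow> z = w"
    by (auto simp: upper_half_plane_def hyp_dist_arsinh)
next
  fix z v w
  assume "z \<in> upper_half_plane" "v \<in> upper_half_plane" "w \<in> upper_half_plane"
  then show "(if z \<in> upper_half_plane \<and> w \<in> upper_half_plane then hyp_dist z w else 0) \<le>
      (if z \<in> upper_half_plane \<and> v \<in> upper_half_plane then hyp_dist z v else 0) +
      (if v \<in> upper_half_plane \<and> w \<in> upper_half_plane then hyp_dist v w else 0)"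
    by (simp add: upper_half_plane_def hyp_dist_triangle)
qed

lemma mspace_hyperbolic_plane [simp]: "mspace hyperbolic_plane = upper_half_plane"
  unfolding hyperbolic_plane_def by (rule Metric_space.mspace_metric[OF Metric_space_hyperbolic_plane])

lemma mdist_hyperbolic_plane [simp]:
  assumes "z \<in> upper_half_plane" "w \<in> upper_half_plane"
  shows "mdist hyperbolic_plane z w = hyp_dist z w"
  unfolding hyperbolic_plane_def
  using assms by (simp add: Metric_space.mdist_metric[OF Metric_space_hyperbolic_plane])


section \<open>The binary tree\<close>

text \<open>
  Vertices are the finite binary sequences, and
  \<^term>\<open>butlast\<close> erases the last term of a sequence.
\<close>

definition tree_edge :: "bool list \<Rightarrow> bool list \<Rightarrow> bool" where
  "tree_edge u v \<longleftrightarrow> (u \<noteq> [] \<and> v = butlast u) \<or> (v \<noteq> [] \<and> u = butlast v)"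

text \<open>
  The tree itself is the metric graph: every edge is a copy of the unit interval.  Points are
  given by barycentric coordinates with respect to the vertices, so that the vertex \<open>v\<close> is
  the point \<open>\<lambda>w. if w = v then 1 else 0\<close>, and \<open>edge_point u v t\<close> is the point of the edge
  \<open>uv\<close> at distance \<open>t\<close> from \<open>u\<close>.
\<close>

definition edge_point :: "bool list \<Rightarrow> bool list \<Rightarrow> real \<Rightarrow> bool list \<Rightarrow> real" where
  "edge_point u v t = (\<lambda>w. if w = u then 1 - t else if w = v then t else 0)"

definition tree_points :: "(bool list \<Rightarrow> real) set" where
  "tree_points = {edge_point u v t | u v t. tree_edge u v \<and> t \<in> {0..1}}"

text \<open>
  \<open>tree_path x y l\<close>: there is a piecewise linear path of length \<open>l\<close> from \<open>x\<close> to \<open>y\<close>, that is, a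
  finite chain of segments each lying in a single edge.
\<close>

inductive tree_path :: "(bool list \<Rightarrow> real) \<Rightarrow> (bool list \<Rightarrow> real) \<Rightarrow> real \<Rightarrow> bool" where
  refl: "x \<in> tree_points \<Longrightarrow> tree_path x x 0"
| step: "\<lbrakk>tree_edge u v; s \<in> {0..1}; t \<in> {0..1}; tree_path (edge_point u v t) y l\<rbrakk>
    \<Longrightarrow> tree_path (edge_point u v s) y (\<bar>s - t\<bar> + l)"

definition tree_dist :: "(bool list \<Rightarrow> real) \<Rightarrow> (bool list \<Rightarrow> real) \<Rightarrow> real" where
  "tree_dist x y = Inf {l. tree_path x y l}"

definition binary_tree :: "(bool list \<Rightarrow> real) metric" where
  "binary_tree =
     metric (tree_points, \<lambda>x y. if x \<in> tree_points \<and> y \<in> tree_points then tree_dist x y else 0)"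

lemma tree_edge_sym: "tree_edge u v \<Longrightarrow> tree_edge v u"
  by (auto simp: tree_edge_def)

lemma tree_edge_neq: "tree_edge u v \<Longrightarrow> u \<noteq> v"
  by (metis append_butlast_last_id not_Cons_self2 self_append_conv tree_edge_def)

lemma edge_point_flip: "u \<noteq> v \<Longrightarrow> edge_point u v t = edge_point v u (1 - t)"
  by (auto simp: edge_point_def)

lemma edge_point_in [intro]:
  "tree_edge u v \<Longrightarrow> t \<in> {0..1} \<Longrightarrow> edge_point u v t \<in> tree_points"
  by (auto simp: tree_points_def)

lemma tree_path_trans: "tree_path x y k \<Longrightarrow> tree_path y z l \<Longrightarrow> tree_path x z (k + l)"
  by (induction rule: tree_path.induct) (auto intro: tree_path.step simp: add.assoc)

lemma tree_path_edge:
  assumes "tree_edge u v" "s \<in> {0..1}" "t \<in> {0..1}"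
  shows "tree_path (edge_point u v s) (edge_point u v t) \<bar>s - t\<bar>"
  using tree_path.step[OF assms tree_path.refl[OF edge_point_in[OF assms(1,3)]]] by simp

lemma tree_path_sym: "tree_path x y l \<Longrightarrow> tree_path y x l"
proof (induction rule: tree_path.induct)
  case (step u v s t y l)
  then have "tree_path y (edge_point u v s) (l + \<bar>t - s\<bar>)"
    by (intro tree_path_trans[OF step.IH] tree_path_edge)
  then show ?case
    by (simp add: abs_minus_commute add.commute)
qed (rule tree_path.refl)

lemma tree_path_nonneg: "tree_path x y l \<Longrightarrow> 0 \<le> l"
  by (induction rule: tree_path.induct) auto

lemma tree_path_coord: "tree_path x y l \<Longrightarrow> \<bar>x w - y w\<bar> \<le> l"
proof (induction rule: tree_path.induct)
  case (step u v s t y l)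
  have "\<bar>edge_point u v s w - edge_point u v t w\<bar> \<le> \<bar>s - t\<bar>"
    by (auto simp: edge_point_def)
  with step.IH show ?case
    by linarith
qed simp

lemma tree_path_root: "\<exists>l. tree_path (edge_point u (u @ [b]) 0) (edge_point [] [True] 0) l"
proof (induction u arbitrary: b rule: rev_induct)
  case Nil
  have "edge_point [] [b] 0 = edge_point [] [True] 0"
    by (auto simp: edge_point_def)
  moreover have "edge_point [] [True] 0 \<in> tree_points"
    by (rule edge_point_in) (auto simp: tree_edge_def)
  ultimately show ?case
    by (auto intro: tree_path.refl)
next
  case (snoc a u)
  have "edge_point (u @ [a]) ((u @ [a]) @ [b]) 0 = edge_point u (u @ [a]) 1"
    by (auto simp: edge_point_def)
  moreover have "tree_edge u (u @ [a])"
    by (simp add: tree_edge_def)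
  ultimately show ?case
    using snoc[of a] tree_path.step[of u "u @ [a]" 1 0] by fastforce
qed

lemma tree_path_ex:
  assumes "x \<in> tree_points" "y \<in> tree_points"
  shows "\<exists>l. tree_path x y l"
proof -
  have to_root: "\<exists>l. tree_path x (edge_point [] [True] 0) l" if x: "x \<in> tree_points" for x
  proof -
    obtain u v t where uv: "tree_edge u v" "t \<in> {0..1}" "x = edge_point u v t"
      using x by (auto simp: tree_points_def)
    have "\<exists>u b t. t \<in> {0..1} \<and> x = edge_point u (u @ [b]) t"
    proof (cases "v \<noteq> [] \<and> u = butlast v")
      case True
      then have "v = u @ [last v]"
        by simp
      with uv show ?thesis
        by metis
    next
      case False
      with uv have "u = v @ [last u]"
        by (metis append_butlast_last_id tree_edge_def)
      moreover have "x = edge_point v u (1 - t)" "1 - t \<in> {0..1}"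
        using uv edge_point_flip[of u v] tree_edge_neq by auto
      ultimately show ?thesis
        by metis
    qed
    then obtain u b t where t: "t \<in> {0..1}" "x = edge_point u (u @ [b]) t"
      by blast
    moreover have "tree_edge u (u @ [b])"
      by (simp add: tree_edge_def)
    ultimately show ?thesis
      using tree_path_root[of u b] tree_path.step[of u "u @ [b]" t 0] by fastforce
  qed
  show ?thesis
    using to_root[OF assms(1)] to_root[OF assms(2)]
    by (blast intro: tree_path_trans tree_path_sym)
qed

lemma tree_dist_le: "tree_path x y l \<Longrightarrow> tree_dist x y \<le> l"
  unfolding tree_dist_def
  by (rule cInf_lower) (auto intro: bdd_belowI[of _ 0] tree_path_nonneg)

lemma tree_dist_ge:
  assumes "x \<in> tree_points" "y \<in> tree_points" "\<And>l. tree_path x y l \<Longrightarrow> c \<le> l"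
  shows "c \<le> tree_dist x y"
  unfolding tree_dist_def using assms tree_path_ex by (intro cInf_greatest) auto

lemma tree_dist_sym: "tree_dist x y = tree_dist y x"
proof -
  have "tree_path x y = tree_path y x"
    by (auto simp: fun_eq_iff intro: tree_path_sym)
  then show ?thesis
    by (simp add: tree_dist_def)
qed

lemma tree_dist_triangle:
  assumes xyz: "x \<in> tree_points" "y \<in> tree_points" "z \<in> tree_points"
  shows "tree_dist x z \<le> tree_dist x y + tree_dist y z"
proof -
  have "tree_dist x z - k \<le> tree_dist y z" if "tree_path x y k" for k
  proof (rule tree_dist_ge)
    show "tree_dist x z - k \<le> l" if "tree_path y z l" for l
      using tree_dist_le[OF tree_path_trans[OF \<open>tree_path x y k\<close> that]] by simp
  qed (use xyz in auto)
  then have "tree_dist x z - tree_dist y z \<le> tree_dist x y"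
    using xyz by (intro tree_dist_ge) (auto simp: algebra_simps)
  then show ?thesis
    by simp
qed

lemma tree_dist_eq_0_iff:
  assumes "x \<in> tree_points" "y \<in> tree_points"
  shows "tree_dist x y = 0 \<longleftrightarrow> x = y"
proof
  assume "tree_dist x y = 0"
  moreover have "\<bar>x w - y w\<bar> \<le> tree_dist x y" for w
    using assms tree_path_coord by (intro tree_dist_ge)
  ultimately show "x = y"
    by (auto simp: fun_eq_iff)
next
  assume "x = y"
  then show "tree_dist x y = 0"
    using assms tree_dist_le[OF tree_path.refl] tree_dist_ge[of x y 0] tree_path_nonneg
    by (metis order_antisym)
qed

lemma Metric_space_binary_tree:
  "Metric_space tree_points
     (\<lambda>x y. if x \<in> tree_points \<and> y \<in> tree_points then tree_dist x y else 0)"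
  by unfold_locales
    (auto simp: tree_dist_sym tree_dist_eq_0_iff tree_dist_triangle
      intro: tree_dist_ge tree_path_nonneg)

lemma mspace_binary_tree [simp]: "mspace binary_tree = tree_points"
  unfolding binary_tree_def by (rule Metric_space.mspace_metric[OF Metric_space_binary_tree])

lemma mdist_binary_tree [simp]:
  assumes "x \<in> tree_points" "y \<in> tree_points"
  shows "mdist binary_tree x y = tree_dist x y"
  unfolding binary_tree_def
  using assms by (simp add: Metric_space.mdist_metric[OF Metric_space_binary_tree])

end

theory Submission
  imports Defs
begin

text \<open>
  In polar coordinates about a base point, with the angle measured in \<open>\<real> / \<int>\<close>, the distance of two
  points of radii \<open>r\<close>, \<open>s\<close> and angles at distance \<open>5\<^sup>-\<^sup>m\<close> (where \<open>m ln 5\<close> is capped by both radii) is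
  \<open>r + s - 2 m ln 5\<close> up to a bounded error.  So the plane is coarsely the set of pairs \<open>(x, k)\<close> of
  an angle and a level, and the coarse geodesic between two of them climbs to the level \<open>m\<close> at
  which their intervals of length \<open>5\<^sup>-\<^sup>m\<close> become equal or adjacent.

  Sending \<open>(x, k)\<close> to the first \<open>k\<close> base-5 digits of \<open>x\<close> is not coarsely Lipschitz, because adjacent
  intervals may have very different digits.  But if two intervals are adjacent without being
  siblings, then below the level where their digits part one has only digits 4 and the other
  only digits 0.  Call the digits 1, 2, 3 eventful.  A map that produces one letter per eventful
  digit, each depending only on the digits before it, gives adjacent intervals words that differ
  in at most one letter, hence is coarsely Lipschitz.  The price is that it ignores points near
  the endpoints of the intervals.  The same map applied to \<open>x + 1 / 2\<close> makes up for this: since 5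
  is odd, each position is eventful for \<open>x\<close> or for \<open>x + 1 / 2\<close> (\<open>eventful_shift\<close>), so the lengths of
  the two words together grow at least as fast as the level.

  The letters must be chosen from a finite alphabet, and still so that two points whose digits
  part at level \<open>m\<close> get words that part soon after, measured against the distance \<open>n\<close> of the
  points from level \<open>m\<close>.  As runs of uneventful digits are arbitrarily long, a letter cannot record
  the run that precedes it.  The letters therefore form a diary with a backlog: digits are put on
  a stack, and at each eventful digit the top \<open>K\<close> entries are removed and written down as one page.
  The latest digits are written first, so after about \<open>n / K\<close> pages everything since level \<open>m\<close> has
  been written.  Running two diaries backwards shows that if they share \<open>p\<close> consecutive pages,
  then their stacks at the first of these pages agree to depth \<open>K p - n\<close> (\<open>common_pages_agree\<close>).
  What is left is that two stacks may carry the same entries at different heights; a page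
  therefore also shows, for each entry, one bit depending on its height, from a sequence
  of bits without long repetitions (\<open>mark_shift\<close>).  So the number of common pages is at most a small
  fraction of \<open>n\<close> (\<open>common_pages_bound\<close>), and the distances in the two trees add up to at least a
  fixed multiple of \<open>n\<close> (\<open>address_pair_dist_ge\<close>).
\<close>

section \<open>The path metric on the vertices of the binary tree\<close>


fun word_dist :: "bool list \<Rightarrow> bool list \<Rightarrow> nat" where
  "word_dist [] v = length v"
| "word_dist u [] = length u"
| "word_dist (a # u) (b # v) = (if a = b then word_dist u v else length u + length v + 2)"

lemma word_dist_append: "word_dist (p @ u) (p @ v) = word_dist u v"
  by (induction p) auto

lemma word_dist_Nil [simp]: "word_dist u [] = length u"
  by (cases u) auto

lemma word_dist_le: "word_dist u v \<le> length u + length v"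
  by (induction u v rule: word_dist.induct) auto

lemma word_dist_split:
  "\<exists>p u' v'. u = p @ u' \<and> v = p @ v' \<and> word_dist u v = length u' + length v'"
proof (induction u v rule: word_dist.induct)
  case (3 a u b v)
  show ?case
  proof (cases "a = b")
    case True
    with 3 obtain p u' v' where "u = p @ u'" "v = p @ v'" "word_dist u v = length u' + length v'"
      by blast
    then have "a # u = (a # p) @ u'" "b # v = (a # p) @ v'"
      "word_dist (a # u) (b # v) = length u' + length v'"
      using True by auto
    then show ?thesis
      by blast
  next
    case False
    then have "a # u = [] @ (a # u)" "b # v = [] @ (b # v)"
      "word_dist (a # u) (b # v) = length (a # u) + length (b # v)"
      by auto
    then show ?thesis
      by blast
  qed
qed (auto intro: exI[of _ "[]"])

lemma word_dist_snoc: "\<bar>real (word_dist u (v @ [b])) - real (word_dist u v)\<bar> \<le> 1"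
proof (induction u v rule: word_dist.induct)
  case (2 a u)
  then show ?case
    by simp
qed auto

lemma word_dist_edge:
  assumes "tree_edge v w"
  shows "\<bar>real (word_dist u v) - real (word_dist u w)\<bar> \<le> 1"
proof -
  have *: "\<bar>real (word_dist u v) - real (word_dist u (butlast v))\<bar> \<le> 1" if "v \<noteq> []" for v
    using word_dist_snoc[of u "butlast v" "last v"] that by simp
  then show ?thesis
    using assms *[of v] *[of w] by (auto simp: tree_edge_def abs_minus_commute)
qed

definition vertex :: "bool list \<Rightarrow> bool list \<Rightarrow> real" where
  "vertex u = (\<lambda>w. if w = u then 1 else 0)"

lemma edge_point_0: "edge_point u v 0 = vertex u"
  by (auto simp: edge_point_def vertex_def)

lemma edge_point_1: "u \<noteq> v \<Longrightarrow> edge_point u v 1 = vertex v"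
  by (auto simp: edge_point_def vertex_def)

lemma vertex_in_tree [simp]: "vertex u \<in> tree_points"
  using edge_point_in[of u "u @ [True]" 0] by (simp add: edge_point_0 tree_edge_def)

lemma tree_path_descend: "tree_path (vertex u) (vertex (u @ v)) (length v)"
proof (induction v arbitrary: u)
  case (Cons b v)
  have "tree_path (edge_point u (u @ [b]) 0) (vertex ((u @ [b]) @ v)) (\<bar>0 - 1\<bar> + real (length v))"
    using Cons[of "u @ [b]"] by (intro tree_path.step) (auto simp: edge_point_1 tree_edge_def)
  then show ?case
    by (simp add: edge_point_0 add.commute)
qed (simp add: tree_path.refl)

text \<open>
  The distance from the vertex \<open>u\<close>, extended linearly along edges.  It is 1-Lipschitz along every
  path, which gives the lower bound on the length of paths.
\<close>

definition dist_from :: "bool list \<Rightarrow> (bool list \<Rightarrow> real) \<Rightarrow> real" where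
  "dist_from u x = (\<Sum>w | x w \<noteq> 0. x w * real (word_dist u w))"

lemma dist_from_edge_point:
  assumes "v \<noteq> w"
  shows "dist_from u (edge_point v w t) = (1 - t) * real (word_dist u v) + t * real (word_dist u w)"
proof -
  have "dist_from u (edge_point v w t) =
      (\<Sum>x\<in>{v, w}. edge_point v w t x * real (word_dist u x))"
    unfolding dist_from_def
    by (rule sum.mono_neutral_left) (auto simp: edge_point_def split: if_splits)
  then show ?thesis
    using assms by (simp add: edge_point_def)
qed

lemma dist_from_vertex: "dist_from u (vertex v) = real (word_dist u v)"
proof -
  have "{w. vertex v w \<noteq> 0} = {v}"
    by (auto simp: vertex_def)
  then show ?thesis
    by (simp add: dist_from_def vertex_def)
qed

lemma tree_path_dist_from: "tree_path x y l \<Longrightarrow> \<bar>dist_from u x - dist_from u y\<bar> \<le> l"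
proof (induction rule: tree_path.induct)
  case (step v w s t y l)
  have "dist_from u (edge_point v w s) - dist_from u (edge_point v w t) =
      (t - s) * (real (word_dist u v) - real (word_dist u w))"
    using tree_edge_neq[OF step.hyps(1)] by (simp add: dist_from_edge_point algebra_simps)
  then have "\<bar>dist_from u (edge_point v w s) - dist_from u (edge_point v w t)\<bar> \<le> \<bar>s - t\<bar>"
    using word_dist_edge[OF step.hyps(1), of u]
    by (simp add: abs_mult abs_minus_commute mult_left_le)
  with step.IH show ?case
    by linarith
qed simp

lemma tree_dist_vertex: "tree_dist (vertex u) (vertex v) = real (word_dist u v)"
proof (rule antisym)
  obtain p u' v' where uv: "u = p @ u'" "v = p @ v'" "word_dist u v = length u' + length v'"
    using word_dist_split by blast
  have "tree_path (vertex u) (vertex v) (real (length u') + real (length v'))"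
    unfolding uv(1,2)
    by (rule tree_path_trans[OF tree_path_sym[OF tree_path_descend] tree_path_descend])
  then show "tree_dist (vertex u) (vertex v) \<le> real (word_dist u v)"
    using tree_dist_le uv(3) by fastforce
  have "dist_from u (vertex u) = 0"
    using word_dist_append[of u "[]" "[]"] by (simp add: dist_from_vertex)
  then show "real (word_dist u v) \<le> tree_dist (vertex u) (vertex v)"
    using tree_path_dist_from[of "vertex u" "vertex v" _ u]
    by (intro tree_dist_ge) (auto simp: dist_from_vertex)
qed

section \<open>A binary sequence without long repetitions\<close>

definition mark :: "int \<Rightarrow> bool" where
  "mark n \<longleftrightarrow> even (multiplicity 2 n)"

lemma mark_odd_mult: "odd j \<Longrightarrow> mark (2 ^ k * j) \<longleftrightarrow> even k"
proof -
  assume "odd j"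
  then have "multiplicity 2 (2 ^ k * j) = k"
    by (intro multiplicity_decomposeI[OF HOL.refl]) auto
  then show ?thesis
    by (simp add: mark_def)
qed

text \<open>
  If \<open>D = 2^k j\<close> with \<open>j\<close> odd, then \<open>2^k (j + 2 + 4 t)\<close> and its translate by \<open>- D\<close> have 2-adic
  valuations \<open>k\<close> and \<open>k + 1\<close>.  Every window of length \<open>4 D\<close> contains such a number.
\<close>

lemma mark_shift:
  fixes h D :: int
  assumes "0 < D"
  shows "\<exists>i<nat (4 * D). mark (h - int i) \<noteq> mark (h - D - int i)"
proof -
  obtain k j where D: "D = 2 ^ k * j" "odd j"
    using assms multiplicity_decompose'[of D 2] by (metis dvd_refl even_numeral less_irrefl not_is_unit_0 odd_one)
  define i where "i = (h - 2 ^ k * (j + 2)) mod 2 ^ (k + 2)"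
  have i: "0 \<le> i" "i < 2 ^ (k + 2)"
    by (simp_all add: i_def)
  define t where "t = (h - 2 ^ k * (j + 2)) div 2 ^ (k + 2)"
  have "h - 2 ^ k * (j + 2) = 2 ^ (k + 2) * t + i"
    unfolding i_def t_def by simp
  then have t: "h - i = 2 ^ k * (j + 2 + 4 * t)" "h - D - i = 2 ^ Suc k * (1 + 2 * t)"
    by (simp_all add: D algebra_simps)
  have "mark (h - i) \<longleftrightarrow> even k"
    unfolding t(1) by (rule mark_odd_mult) (use D in simp)
  moreover have "mark (h - D - i) \<longleftrightarrow> even (Suc k)"
    unfolding t(2) by (rule mark_odd_mult) simp
  moreover have "i < 4 * D"
  proof -
    have "0 < j"
      using assms D by (simp add: zero_less_mult_iff)
    then have "(2::int) ^ (k + 2) * 1 \<le> 2 ^ (k + 2) * j"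
      by (intro mult_left_mono) auto
    also have "(2::int) ^ (k + 2) * j = 4 * D"
      by (simp add: D)
    finally show ?thesis
      using i(2) by linarith
  qed
  ultimately show ?thesis
    using i(1) by (intro exI[of _ "nat i"]) auto
qed


section \<open>Diaries\<close>

datatype digit = Zero | One | Two | Three | Four

definition eventful :: "digit \<Rightarrow> bool" where
  "eventful d \<longleftrightarrow> d \<noteq> Zero \<and> d \<noteq> Four"

text \<open>
  The stack is given by its entries from the top downwards and by the height \<open>h\<close> of its top entry.
  It has no bottom, so heights are arbitrary integers.
\<close>

definition page :: "nat \<Rightarrow> (nat \<Rightarrow> digit) \<Rightarrow> int \<Rightarrow> (digit \<times> bool) list" where
  "page K S h = map (\<lambda>i. (S i, mark (h - int i))) [0..<K]"

text \<open>
  The page is written before the eventful digit is pushed: all points with the same earlier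
  digits, whichever of the digits 1, 2, 3 follows, write the same page.
\<close>

fun diary :: "nat \<Rightarrow> (nat \<Rightarrow> digit) \<Rightarrow> int \<Rightarrow> digit list \<Rightarrow> (digit \<times> bool) list list" where
  "diary K S h [] = []"
| "diary K S h (d # ds) =
     (if eventful d
      then page K S h # diary K (case_nat d (\<lambda>i. S (i + K))) (h - int K + 1) ds
      else diary K (case_nat d S) (h + 1) ds)"

lemma length_diary: "length (diary K S h ds) = length (filter eventful ds)"
  by (induction ds arbitrary: S h) auto

lemma diary_append: "\<exists>S' h'. \<forall>ds'. diary K S h (ds @ ds') = diary K S h ds @ diary K S' h' ds'"
proof (induction ds arbitrary: S h)
  case (Cons d ds)
  show ?case
  proof (cases "eventful d")
    case True
    with Cons[of "case_nat d (\<lambda>i. S (i + K))" "h - int K + 1"] show ?thesis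
      by auto
  next
    case False
    with Cons[of "case_nat d S" "h + 1"] show ?thesis
      by auto
  qed
qed auto

primrec pushes :: "digit list \<Rightarrow> (nat \<Rightarrow> digit) \<Rightarrow> nat \<Rightarrow> digit" where
  "pushes [] S = S"
| "pushes (d # u) S = pushes u (case_nat d S)"

lemma pushes_nth:
  "pushes u S i = (if i < length u then u ! (length u - 1 - i) else S (i - length u))"
proof (induction u arbitrary: S i)
  case (Cons d u)
  consider "i < length u" | "i = length u" | j where "i = Suc (length u + j)"
    by (metis add_Suc_right less_imp_Suc_add linorder_less_linear)
  then show ?case
  proof cases
    case 1
    then show ?thesis
      using Cons by (simp add: nth_Cons' Suc_diff_Suc[symmetric] del: diff_Suc_Suc)
  qed (use Cons in simp_all)
qed simp

lemma pushes_mem: "i < length u \<Longrightarrow> pushes u S i \<in> set u"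
  by (simp add: pushes_nth)

lemma diary_quiet:
  assumes "\<forall>d\<in>set u. \<not> eventful d"
  shows "diary K S h (u @ ds) = diary K (pushes u S) (h + int (length u)) ds"
  using assms by (induction u arbitrary: S h) (auto simp: add.assoc)

lemma diary_event:
  assumes "\<forall>d\<in>set u. \<not> eventful d" "eventful f"
  shows "diary K S h (u @ f # ds) =
    page K (pushes u S) (h + int (length u)) #
    diary K (case_nat f (\<lambda>i. pushes u S (i + K))) (h + int (length u) - int K + 1) ds"
  using assms by (simp add: diary_quiet)

lemma first_event:
  assumes "0 < length (diary K S h ds)"
  obtains u f ds' where "ds = u @ f # ds'" "\<forall>d\<in>set u. \<not> eventful d" "eventful f"
  using assms split_list_first_prop[of ds eventful]
  by (metis filter_False length_diary less_numeral_extra(3) list.size(3))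

definition agree :: "nat \<Rightarrow> (nat \<Rightarrow> digit) \<Rightarrow> int \<Rightarrow> (nat \<Rightarrow> digit) \<Rightarrow> int \<Rightarrow> bool" where
  "agree r S h S' h' \<longleftrightarrow> (\<forall>i<r. S i = S' i \<and> mark (h - int i) = mark (h' - int i))"

lemma page_eq_iff: "page K S h = page K S' h' \<longleftrightarrow> agree K S h S' h'"
  by (auto simp: page_def agree_def)

lemma agree_mono: "agree r S h S' h' \<Longrightarrow> q \<le> r \<Longrightarrow> agree q S h S' h'"
  by (auto simp: agree_def)

lemma agree_heights:
  assumes "agree r S h S' h'" "int r \<ge> 4 * \<bar>h - h'\<bar>"
  shows "h = h'"
proof -
  have False if "h' < h" "\<forall>i<r. mark (h - int i) = mark (h' - int i)" "int r \<ge> 4 * (h - h')" for h h'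
    using mark_shift[of "h - h'" h] that by fastforce
  from this[of h' h] this[of h h'] show ?thesis
    using assms by (fastforce simp: agree_def)
qed

text \<open>
  Going backwards over one page, the \<open>K\<close> entries removed at that page are known from the page, and
  the entries pushed since the previous page are those down to the first eventful one.  Hence if
  the stacks at a page agree to depth \<open>r\<close> and the run \<open>v\<close> of uneventful digits precedes that page,
  the stacks at the previous page agree to depth \<open>K + (r - (length v + 1))\<close>, with truncated
  subtraction.  Only the digits of one of the two diaries enter the bound.
\<close>

lemma common_pages_agree:
  assumes "\<forall>d\<in>set u. \<not> eventful d" "eventful f" "\<forall>d\<in>set u'. \<not> eventful d" "eventful f'"
    and "take (Suc p) (diary K S h (u @ f # ds)) = take (Suc p) (diary K S' h' (u' @ f' # ds'))"
    and "p < length (diary K S h (u @ f # ds))" "p < length (diary K S' h' (u' @ f' # ds'))"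
  shows "agree (K * Suc p - length ds)
    (pushes u S) (h + int (length u)) (pushes u' S') (h' + int (length u'))"
  using assms
proof (induction p arbitrary: S h u f ds S' h' u' f' ds')
  case 0
  then have "agree K (pushes u S) (h + int (length u)) (pushes u' S') (h' + int (length u'))"
    by (simp add: diary_event page_eq_iff)
  then show ?case
    by (rule agree_mono) simp
next
  case (Suc p)
  define P k where "P = pushes u S" and "k = h + int (length u)"
  define P' k' where "P' = pushes u' S'" and "k' = h' + int (length u')"
  define T where "T = case_nat f (\<lambda>i. P (i + K))"
  define T' where "T' = case_nat f' (\<lambda>i. P' (i + K))"
  have d: "diary K S h (u @ f # ds) = page K P k # diary K T (k - int K + 1) ds"
    "diary K S' h' (u' @ f' # ds') = page K P' k' # diary K T' (k' - int K + 1) ds'"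
    using Suc.prems by (simp_all add: diary_event P_def k_def P'_def k'_def T_def T'_def)
  have top: "agree K P k P' k'"
    using Suc.prems(5) by (simp add: d page_eq_iff)
  have rest: "take (Suc p) (diary K T (k - int K + 1) ds) = take (Suc p) (diary K T' (k' - int K + 1) ds')"
    "p < length (diary K T (k - int K + 1) ds)" "p < length (diary K T' (k' - int K + 1) ds')"
    using Suc.prems(5-7) by (simp_all add: d)
  obtain v g es where v: "ds = v @ g # es" "\<forall>d\<in>set v. \<not> eventful d" "eventful g"
    using first_event rest(2) by (metis not_less_zero neq0_conv)
  obtain v' g' es' where v': "ds' = v' @ g' # es'" "\<forall>d\<in>set v'. \<not> eventful d" "eventful g'"
    using first_event rest(3) by (metis not_less_zero neq0_conv)
  define r where "r = K * Suc p - length es"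
  have A: "agree r (pushes v T) (k - int K + 1 + int (length v))
      (pushes v' T') (k' - int K + 1 + int (length v'))"
    unfolding r_def using rest v v' by (intro Suc.IH[of v g v' g']) simp_all
  have quiet: "\<not> eventful (pushes v T i)" if "i < length v" for i
    using that v(2) by (simp add: pushes_nth)
  have quiet': "\<not> eventful (pushes v' T' i)" if "i < length v'" for i
    using that v'(2) by (simp add: pushes_nth)
  have ev: "eventful (pushes v T (length v))" "eventful (pushes v' T' (length v'))"
    using Suc.prems by (simp_all add: pushes_nth T_def T'_def)
  \<comment> \<open>The topmost eventful entry is the first entry pushed after the previous page.\<close>
  have "agree (K + (r - Suc (length v))) P k P' k'"
  proof (cases "r \<le> length v")
    case True
    with top show ?thesis
      by simp
  next
    case False
    have eq: "length v' = length v"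
    proof (rule ccontr)
      assume "length v' \<noteq> length v"
      then consider "length v' < length v" | "length v < length v'"
        by linarith
      then show False
      proof cases
        case 1
        then have "pushes v T (length v') = pushes v' T' (length v')"
          using A False by (auto simp: agree_def)
        then show False
          using quiet[OF 1] ev by simp
      next
        case 2
        then have "pushes v T (length v) = pushes v' T' (length v)"
          using A False by (auto simp: agree_def)
        then show False
          using quiet'[OF 2] ev by simp
      qed
    qed
    show ?thesis
      unfolding agree_def
    proof (intro allI impI)
      fix i assume i: "i < K + (r - Suc (length v))"
      show "P i = P' i \<and> mark (k - int i) = mark (k' - int i)"
      proof (cases "i < K")
        case True
        with top show ?thesis
          by (simp add: agree_def)
      next
        case F: False
        define t where "t = Suc (length v) + (i - K)"
        have t: "t < r" "t - length v = Suc (i - K)" "\<not> t < length v"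
          using i F False by (auto simp: t_def)
        have "pushes v T t = pushes v' T' t"
          "mark (k - int K + 1 + int (length v) - int t) = mark (k' - int K + 1 + int (length v') - int t)"
          using A t(1) by (auto simp: agree_def)
        moreover have "pushes v T t = P i" "pushes v' T' t = P' i"
          using t(2,3) F eq by (simp_all add: pushes_nth T_def T'_def)
        moreover have "k - int K + 1 + int (length v) - int t = k - int i"
          "k' - int K + 1 + int (length v') - int t = k' - int i"
          using F eq by (simp_all add: t_def)
        ultimately show ?thesis
          by simp
      qed
    qed
  qed
  then show ?case
    unfolding P_def P'_def k_def k'_def
    by (rule agree_mono) (simp add: r_def v(1))
qed



section \<open>How long two diaries can agree\<close>

text \<open>
  Sharing many pages makes the stacks at the first page agree to depth \<open>4 n\<close>, marks included.  The
  heights differ by at most \<open>n\<close>, so \<open>mark_shift\<close> makes them equal; then as many digits have been read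
  in both diaries, and the stacks contain all of them.  If both \<open>d\<close> and \<open>d'\<close> are eventful, they are pushed
  only after the first page and the second page has to be considered.
\<close>

lemma common_pages_diverging:
  assumes v: "length (d # w) \<le> n" and v': "length (d' # w') \<le> n" and "d \<noteq> d'"
    and take_q: "take q (diary K S h (d # w)) = take q (diary K S h (d' # w'))"
    and q: "q \<le> length (diary K S h (d # w))" "q \<le> length (diary K S h (d' # w'))"
  shows "K * q \<le> K + 5 * n"
proof (rule ccontr)
  assume "\<not> K * q \<le> K + 5 * n"
  then have large: "K + 5 * n < K * q"
    by simp
  obtain p where p: "q = Suc (Suc p)"
    using large by (metis One_nat_def add_lessD1 less_irrefl_nat mult.right_neutral mult_0_right not_less_zero old.nat.exhaust)
  have large': "5 * n < K * Suc p"
    using large p by simp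
  obtain u f ds where u: "d # w = u @ f # ds" "\<forall>d\<in>set u. \<not> eventful d" "eventful f"
    using first_event[of K S h "d # w"] q p by (metis less_le_trans zero_less_Suc)
  obtain u' f' ds' where u': "d' # w' = u' @ f' # ds'" "\<forall>d\<in>set u'. \<not> eventful d" "eventful f'"
    using first_event[of K S h "d' # w'"] q p by (metis less_le_trans zero_less_Suc)
  have len: "length u + Suc (length ds) \<le> n" "length u' + Suc (length ds') \<le> n"
    using v v' u(1) u'(1) by (metis length_Cons length_append)+
  have "agree (K * Suc (Suc p) - length ds)
      (pushes u S) (h + int (length u)) (pushes u' S) (h + int (length u'))"
    using take_q q p u u' by (intro common_pages_agree[of u f u' f']) auto
  then have A: "agree (4 * n) (pushes u S) (h + int (length u)) (pushes u' S) (h + int (length u'))"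
    by (rule agree_mono) (use large p len in simp)
  have "h + int (length u) = h + int (length u')"
    by (rule agree_heights[OF A]) (use len in simp)
  then have eq: "length u = length u'"
    by simp
  show False
  proof (cases "u = []")
    case False
    then have "length u - 1 < 4 * n" "length u - 1 < length u"
      using len by auto
    then have "u ! 0 = u' ! 0"
      using A eq by (auto simp: agree_def pushes_nth)
    moreover have "u ! 0 = d" "u' ! 0 = d'"
      using u(1) u'(1) False eq by (metis append_Cons hd_append2 hd_conv_nth length_0_conv list.sel(1))+
    ultimately show False
      using \<open>d \<noteq> d'\<close> by simp
  next
    case True
    with eq u u' have nil: "u' = []" "f = d" "f' = d'" "ds = w" "ds' = w'"
      by auto
    define T where "T = (\<lambda>i. S (i + K))"
    have d: "diary K S h (d # w) = page K S h # diary K (case_nat d T) (h - int K + 1) w"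
      "diary K S h (d' # w') = page K S h # diary K (case_nat d' T) (h - int K + 1) w'"
      using u(3) u'(3) nil by (simp_all add: T_def)
    have rest: "take (Suc p) (diary K (case_nat d T) (h - int K + 1) w) =
        take (Suc p) (diary K (case_nat d' T) (h - int K + 1) w')"
      "p < length (diary K (case_nat d T) (h - int K + 1) w)"
      "p < length (diary K (case_nat d' T) (h - int K + 1) w')"
      using take_q q p unfolding d by auto
    obtain x g es where x: "w = x @ g # es" "\<forall>d\<in>set x. \<not> eventful d" "eventful g"
      using first_event rest(2) by (metis not_less_zero neq0_conv)
    obtain x' g' es' where x': "w' = x' @ g' # es'" "\<forall>d\<in>set x'. \<not> eventful d" "eventful g'"
      using first_event rest(3) by (metis not_less_zero neq0_conv)
    have "agree (K * Suc p - length es)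
        (pushes x (case_nat d T)) (h - int K + 1 + int (length x))
        (pushes x' (case_nat d' T)) (h - int K + 1 + int (length x'))"
      using rest x x' by (intro common_pages_agree[of x g x' g']) auto
    then have A2: "agree (4 * n)
        (pushes x (case_nat d T)) (h - int K + 1 + int (length x))
        (pushes x' (case_nat d' T)) (h - int K + 1 + int (length x'))"
      by (rule agree_mono) (use large' v x(1) in simp)
    have "h - int K + 1 + int (length x) = h - int K + 1 + int (length x')"
      by (rule agree_heights[OF A2]) (use v v' x(1) x'(1) in simp)
    moreover have "length x < 4 * n"
      using v x(1) by simp
    ultimately have "pushes x (case_nat d T) (length x) = pushes x' (case_nat d' T) (length x')"
      using A2 by (auto simp: agree_def)
    then show False
      using \<open>d \<noteq> d'\<close> by (simp add: pushes_nth)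
  qed
qed

text \<open>
  The next two lemmas deal with intervals that are adjacent at the level in question although
  their digits part \<open>r > n\<close> levels higher up, too far for \<open>common_pages_diverging\<close>.
  Here the depth \<open>n\<close> of the stacks at the first page lies within the two runs.
\<close>

lemma common_pages_distinct_runs:
  assumes e: "\<not> eventful e" "\<not> eventful e'" "e \<noteq> e'"
    and len: "length u \<le> n" "length u' \<le> n" "n < r"
    and take_q: "take q (diary K S h (replicate r e @ u)) = take q (diary K S' h' (replicate r e' @ u'))"
    and q: "q \<le> length (diary K S h (replicate r e @ u))"
      "q \<le> length (diary K S' h' (replicate r e' @ u'))"
  shows "K * q \<le> 2 * n"
proof (rule ccontr)
  assume large: "\<not> K * q \<le> 2 * n"
  then obtain p where p: "q = Suc p"
    by (cases q) auto
  have "0 < length (filter eventful u)" "0 < length (filter eventful u')"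
    using q e p by (auto simp: length_diary filter_replicate simp del: length_greater_0_conv)
  then obtain v f ds v' f' ds' where
    v: "u = v @ f # ds" "\<forall>d\<in>set v. \<not> eventful d" "eventful f" and
    v': "u' = v' @ f' # ds'" "\<forall>d\<in>set v'. \<not> eventful d" "eventful f'"
    using first_event[of K S h] by (metis length_diary)
  have "agree (K * Suc p - length ds)
      (pushes (replicate r e @ v) S) (h + int (length (replicate r e @ v)))
      (pushes (replicate r e' @ v') S') (h' + int (length (replicate r e' @ v')))"
    using take_q q p v v' e by (intro common_pages_agree[of _ f _ f']) auto
  moreover have "n < K * Suc p - length ds"
    using large p len v(1) by simp
  ultimately have "pushes (replicate r e @ v) S n = pushes (replicate r e' @ v') S' n"
    by (auto simp: agree_def)
  moreover have "pushes (replicate r e @ v) S n = e" "pushes (replicate r e' @ v') S' n = e'"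
    using len v(1) v'(1) by (auto simp: pushes_nth nth_append)
  ultimately show False
    using e by simp
qed

text \<open>
  If only the second diary writes a page before its run, then the second page of the first diary
  is compared with a page of the other that follows the whole run: at small depth, the
  stack of the first has an eventful entry and the stack of the second has none.
\<close>

lemma common_pages_missed_event:
  assumes e: "\<not> eventful z" "\<not> eventful e" "eventful z'" "\<not> eventful e'"
    and len: "length u \<le> n" "length u' \<le> n" "n < r"
    and take_q: "take q (diary K S h (z # replicate r e @ u)) =
      take q (diary K S' h' (z' # replicate r e' @ u'))"
    and q: "q \<le> length (diary K S h (z # replicate r e @ u))"
      "q \<le> length (diary K S' h' (z' # replicate r e' @ u'))"
  shows "K * q \<le> K + 2 * n"
proof (rule ccontr)
  assume large: "\<not> K * q \<le> K + 2 * n"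
  obtain p where p: "q = Suc (Suc p)"
    using large by (metis One_nat_def add_leD1 le_add1 mult.right_neutral mult_0_right not0_implies_Suc zero_le)
  have "0 < length (filter eventful u)"
    using q e p by (auto simp: length_diary filter_replicate simp del: length_greater_0_conv)
  then obtain v f ds where v: "u = v @ f # ds" "\<forall>d\<in>set v. \<not> eventful d" "eventful f"
    using first_event[of K S h] by (metis length_diary)
  have quiet: "\<forall>d\<in>set (z # replicate r e @ v). \<not> eventful d"
    using v(2) e by auto
  define T k where "T = case_nat f (\<lambda>i. pushes (z # replicate r e @ v) S (i + K))"
    and "k = h + int (length (z # replicate r e @ v)) - int K + 1"
  define T' where "T' = case_nat z' (\<lambda>i. S' (i + K))"
  have d: "diary K S h (z # replicate r e @ u) =
      page K (pushes (z # replicate r e @ v) S) (h + int (length (z # replicate r e @ v))) # diary K T k ds"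
    using diary_event[OF quiet v(3), of K S h ds] v(1) by (simp add: T_def k_def)
  have d': "diary K S' h' (z' # replicate r e' @ u') =
      page K S' h' # diary K T' (h' - int K + 1) (replicate r e' @ u')"
    using e by (simp add: T'_def)
  have rest: "take (Suc p) (diary K T k ds) = take (Suc p) (diary K T' (h' - int K + 1) (replicate r e' @ u'))"
    "p < length (diary K T k ds)" "p < length (diary K T' (h' - int K + 1) (replicate r e' @ u'))"
    using take_q q p unfolding d d' by auto
  obtain w g es where w: "ds = w @ g # es" "\<forall>d\<in>set w. \<not> eventful d" "eventful g"
    using first_event rest(2) by (metis not_less_zero neq0_conv)
  have "0 < length (filter eventful u')"
    using rest(3) e by (auto simp: length_diary filter_replicate simp del: length_greater_0_conv)
  then obtain w' g' es' where w': "u' = w' @ g' # es'" "\<forall>d\<in>set w'. \<not> eventful d" "eventful g'"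
    using first_event[of K S h] by (metis length_diary)
  have "agree (K * Suc p - length es) (pushes w T) (k + int (length w))
      (pushes (replicate r e' @ w') T') (h' - int K + 1 + int (length (replicate r e' @ w')))"
    using rest w w' e by (intro common_pages_agree[of w g _ g']) auto
  moreover have "length w < K * Suc p - length es"
    using large p len v(1) w(1) by simp
  ultimately have "pushes w T (length w) = pushes (replicate r e' @ w') T' (length w)"
    by (auto simp: agree_def)
  moreover have "pushes w T (length w) = f"
    by (simp add: pushes_nth T_def)
  moreover have "\<not> eventful (pushes (replicate r e' @ w') T' (length w))"
  proof -
    have *: "length w < length (replicate r e' @ w')"
      using len v(1) w(1) by simp
    show ?thesis
      using pushes_mem[OF *, of T'] e(4) w'(2) by (auto split: if_splits)
  qed
  ultimately show False
    using v(3) by simp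
qed

text \<open>
  The shapes of the expansions of two adjacent or equal intervals of the same level in the circle
  \<open>\<real> / \<int>\<close>.  The rule \<open>wrap\<close> is for the intervals on both sides of 0.
\<close>

inductive neighbouring :: "digit list \<Rightarrow> digit list \<Rightarrow> bool" where
  same: "neighbouring s s"
| wrap: "\<lbrakk>\<not> eventful e; \<not> eventful e'; e \<noteq> e'\<rbrakk> \<Longrightarrow> neighbouring (replicate r e) (replicate r e')"
| carry: "\<lbrakk>\<not> eventful e; \<not> eventful e'; e \<noteq> e'; d \<noteq> d'; eventful d \<or> eventful d'\<rbrakk> \<Longrightarrow>
    neighbouring (c @ d # replicate r e) (c @ d' # replicate r e')"

lemma neighbouring_sym: "neighbouring s t \<Longrightarrow> neighbouring t s"
  by (induction rule: neighbouring.induct) (blast intro: neighbouring.intros)+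

text \<open>
  The source of the Lipschitz property: after the common pages, each of the two expansions writes
  at most one page more, as the runs write none.
\<close>

lemma neighbouring_common_pages:
  assumes "neighbouring s t"
  shows "\<exists>p. (\<forall>ds. \<exists>ds'. diary K S h (s @ ds) = p @ ds' \<and>
      length ds' \<le> length ds + 1) \<and>
     (\<forall>ds. \<exists>ds'. diary K S h (t @ ds) = p @ ds' \<and> length ds' \<le> length ds + 1)"
  using assms
proof cases
  case same
  obtain S' h' where S': "\<And>ds. diary K S h (s @ ds) = diary K S h s @ diary K S' h' ds"
    using diary_append by blast
  have "length (diary K S' h' ds) \<le> length ds + 1" for ds
    by (simp add: length_diary le_SucI)
  then show ?thesis
    unfolding same using S' by (intro exI[of _ "diary K S h s"]) auto
next
  case (wrap e e' r)
  have "length (diary K S h (replicate r a @ ds)) \<le> length ds + 1" if "\<not> eventful a" for a ds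
    using that by (simp add: length_diary filter_replicate le_SucI[OF length_filter_le])
  then show ?thesis
    unfolding wrap(1,2) using wrap(3,4) by (intro exI[of _ "[]"]) auto
next
  case (carry e e' d d' c r)
  obtain S' h' where S': "\<And>ds. diary K S h (c @ ds) = diary K S h c @ diary K S' h' ds"
    using diary_append by blast
  have "length (diary K S' h' (b # replicate r a @ ds)) \<le> length ds + 1" if "\<not> eventful a" for a b ds
    using that by (simp add: length_diary filter_replicate le_SucI[OF length_filter_le])
  then show ?thesis
    unfolding carry(1,2) using carry(3,4) by (intro exI[of _ "diary K S h c"]) (auto simp: S')
qed

text \<open>
  If the digits parted at most \<open>n\<close> levels above the end of \<open>s\<close> and \<open>t\<close>, the run is treated as part
  of the later digits, so that \<open>common_pages_diverging\<close> applies with \<open>2 n + 1\<close> for \<open>n\<close>.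
\<close>

lemma common_pages_bound:
  assumes "neighbouring s t"
    and len: "length v \<le> n" "length v' \<le> n"
    and div: "v = [] \<or> v' = [] \<or> s @ take 1 v \<noteq> t @ take 1 v'"
    and lst: "length s = length t"
    and take_q: "take q (diary K S h (s @ v)) = take q (diary K S h (t @ v'))"
    and q: "q \<le> length (diary K S h (s @ v))" "q \<le> length (diary K S h (t @ v'))"
  shows "K * q \<le> K * min (length (filter eventful s)) (length (filter eventful t)) + K + 10 * n + 5"
  using assms(1)
proof cases
  case same
  obtain S' h' where S': "\<And>ds. diary K S h (s @ ds) = diary K S h s @ diary K S' h' ds"
    using diary_append by blast
  show ?thesis
  proof (cases "q \<le> length (diary K S h s)")
    case True
    then have "K * q \<le> K * length (filter eventful s)"
      unfolding length_diary by (rule mult_le_mono2)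
    then show ?thesis
      unfolding same min.idem by linarith
  next
    case False
    then obtain j where j: "q = length (diary K S h s) + j"
      by (metis le_add_diff_inverse nat_le_linear)
    have tj: "take j (diary K S' h' v) = take j (diary K S' h' v')"
      "j \<le> length (diary K S' h' v)" "j \<le> length (diary K S' h' v')"
      using take_q q j unfolding same S'[unfolded same] by auto
    have "K * j \<le> K + 5 * n"
    proof (cases "v = [] \<or> v' = []")
      case True
      then have "j = 0"
        using tj by auto
      then show ?thesis
        by simp
    next
      case False
      then obtain d w d' w' where v: "v = d # w" "v' = d' # w'"
        by (metis neq_Nil_conv)
      then have "d \<noteq> d'"
        using div same by auto
      from common_pages_diverging[OF _ _ this tj[unfolded v]] show ?thesis
        using len v by simp
    qed
    then show ?thesis
      using same by (simp add: j length_diary algebra_simps)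
  qed
next
  case (wrap e e' r)
  have *: "filter eventful s = []" "filter eventful t = []"
    using wrap by (simp_all add: filter_replicate)
  consider "r = 0" | "0 < r" "r \<le> n" | "n < r"
    by linarith
  then have "K * q \<le> K + 10 * n"
  proof cases
    case 1
    with wrap have nil: "s = []" "t = []"
      by auto
    show ?thesis
    proof (cases "v = [] \<or> v' = []")
      case True
      then have "q = 0"
        using q nil by auto
      then show ?thesis
        by simp
    next
      case False
      then obtain d w d' w' where v: "v = d # w" "v' = d' # w'"
        by (metis neq_Nil_conv)
      then have "d \<noteq> d'"
        using div nil by auto
      from common_pages_diverging[OF _ _ this take_q[unfolded nil v append_Nil] q[unfolded nil v append_Nil]]
      have "K * q \<le> K + 5 * n"
        using len v by simp
      then show ?thesis
        by simp
    qed
  next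
    case 2
    then obtain r' where r': "r = Suc r'"
      by (metis gr0_implies_Suc)
    have *: "s = e # replicate r' e" "t = e' # replicate r' e'"
      using wrap r' by simp_all
    have "K * q \<le> K + 5 * (2 * n)"
      using common_pages_diverging[OF _ _ wrap(5) take_q[unfolded * append_Cons] q[unfolded * append_Cons], of "2 * n"]
        len 2 r' by simp
    then show ?thesis
      by simp
  next
    case 3
    have "K * q \<le> 2 * n"
      by (rule common_pages_distinct_runs[OF wrap(3,4,5) len 3 take_q[unfolded wrap(1,2)] q[unfolded wrap(1,2)]])
    then show ?thesis
      by simp
  qed
  then show ?thesis
    by (simp add: *)
next
  case (carry e e' d d' c r)
  obtain S' h' where S': "\<And>ds. diary K S h (c @ ds) = diary K S h c @ diary K S' h' ds"
    using diary_append by blast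
  define A where "A = min (length (filter eventful s)) (length (filter eventful t))"
  have A: "length (diary K S h c) \<le> A"
    using carry by (simp add: A_def length_diary)
  show ?thesis
  proof (cases "q \<le> length (diary K S h c)")
    case True
    then have "K * q \<le> K * A"
      using A by (intro mult_le_mono2) simp
    then show ?thesis
      unfolding A_def by linarith
  next
    case False
    then obtain j where j: "q = length (diary K S h c) + j"
      by (metis le_add_diff_inverse nat_le_linear)
    have tj: "take j (diary K S' h' (d # replicate r e @ v)) = take j (diary K S' h' (d' # replicate r e' @ v'))"
      "j \<le> length (diary K S' h' (d # replicate r e @ v))"
      "j \<le> length (diary K S' h' (d' # replicate r e' @ v'))"
      using take_q q j unfolding carry by (auto simp: S')
    have "K * j \<le> K + 10 * n + 5"
    proof (cases "r \<le> n")
      case True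
      have "K * j \<le> K + 5 * (2 * n + 1)"
        using common_pages_diverging[OF _ _ carry(6) tj, of "2 * n + 1"] True len by simp
      then show ?thesis
        by simp
    next
      case False
      consider "eventful d" "eventful d'" | "\<not> eventful d" "eventful d'" | "eventful d" "\<not> eventful d'"
        using carry(7) by blast
      then have "K * j \<le> K + 2 * n"
      proof cases
        case 1
        show ?thesis
        proof (cases j)
          case (Suc i)
          define T where "T = (\<lambda>b. case_nat b (\<lambda>i. S' (i + K)))"
          have "take i (diary K (T d) (h' - int K + 1) (replicate r e @ v)) =
              take i (diary K (T d') (h' - int K + 1) (replicate r e' @ v'))"
            "i \<le> length (diary K (T d) (h' - int K + 1) (replicate r e @ v))"
            "i \<le> length (diary K (T d') (h' - int K + 1) (replicate r e' @ v'))"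
            using tj 1 Suc by (simp_all add: T_def)
          from common_pages_distinct_runs[OF carry(3,4,5) len _ this] have "K * i \<le> 2 * n"
            using False by simp
          then show ?thesis
            by (simp add: Suc)
        qed simp
      next
        case 2
        show ?thesis
          using common_pages_missed_event[OF 2(1) carry(3) 2(2) carry(4) len _ tj] False by simp
      next
        case 3
        show ?thesis
          using common_pages_missed_event[OF 3(2) carry(4) 3(1) carry(3) len(2,1) _ tj(1)[symmetric] tj(3,2)]
            False by simp
      qed
      then show ?thesis
        by simp
    qed
    moreover have "K * length (diary K S h c) \<le> K * A"
      using A by (rule mult_le_mono2)
    ultimately show ?thesis
      unfolding j A_def[symmetric] add_mult_distrib2 by linarith
  qed
qed



section \<open>Diaries as binary words\<close>

definition letter_code :: "digit \<times> bool \<Rightarrow> bool list" where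
  "letter_code = (\<lambda>(d, b). [d = One \<or> d = Three, d = Two \<or> d = Three, d = Four, b])"

lemma inj_letter_code: "inj letter_code"
proof (rule injI)
  fix x y
  assume "letter_code x = letter_code y"
  then show "x = y"
    by (cases x; cases y; cases "fst x"; cases "fst y") (auto simp: letter_code_def)
qed

lemma length_letter_code: "length (letter_code x) = 4"
  by (cases x) (simp add: letter_code_def)

lemma concat_map_inj:
  assumes "inj f" "\<And>x. length (f x) = B" "length xs = length ys"
    "concat (map f xs) = concat (map f ys)"
  shows "xs = ys"
  using assms(3,4)
proof (induction xs ys rule: list_induct2)
  case (Cons x xs y ys)
  then show ?case
    using assms(1,2) by (auto simp: append_eq_append_conv inj_eq)
qed simp

lemma length_concat_map:
  assumes "\<forall>x\<in>set xs. length (f x) = B"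
  shows "length (concat (map f xs)) = B * length xs"
  using assms by (induction xs) auto

lemma word_dist_distinct_blocks:
  "length a = length b \<Longrightarrow> a \<noteq> b \<Longrightarrow> length u + length v \<le> word_dist (a @ u) (b @ v)"
  by (induction a b rule: list_induct2) auto

lemma word_dist_concat_ge:
  assumes f: "\<forall>x\<in>set xs \<union> set ys. length (f x) = B" "inj_on f (set xs \<union> set ys)"
  shows "\<exists>q. take q xs = take q ys \<and> q \<le> length xs \<and> q \<le> length ys \<and>
    B * (length xs + length ys) \<le> word_dist (concat (map f xs)) (concat (map f ys)) + 2 * B * q + 2 * B"
  using f
proof (induction xs arbitrary: ys)
  case Nil
  then show ?case
    by (simp add: length_concat_map[of ys f B])
next
  case (Cons x xs)
  show ?case
  proof (cases ys)
    case Nil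
    have "length (concat (map f (x # xs))) = B * length (x # xs)"
      using Cons.prems by (intro length_concat_map) auto
    then have "word_dist (concat (map f (x # xs))) (concat (map f ys)) = B * length (x # xs)"
      unfolding Nil by simp
    then show ?thesis
      using Nil by (intro exI[of _ 0]) simp
  next
    case ys: (Cons y ys')
    show ?thesis
    proof (cases "x = y")
      case True
      have "inj_on f (set xs \<union> set ys')"
        using Cons.prems(2) ys by (auto intro: inj_on_subset)
      then obtain q where "take q xs = take q ys'" "q \<le> length xs" "q \<le> length ys'"
        "B * (length xs + length ys') \<le>
          word_dist (concat (map f xs)) (concat (map f ys')) + 2 * B * q + 2 * B"
        using Cons.IH[of ys'] Cons.prems(1) ys by auto
      then show ?thesis
        using True ys
        by (intro exI[of _ "Suc q"]) (auto simp: word_dist_append algebra_simps)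
    next
      case False
      have "length (f x) = length (f y)" "f x \<noteq> f y"
        using Cons.prems ys False by (auto simp: inj_on_def)
      then have "length (concat (map f xs)) + length (concat (map f ys')) \<le>
          word_dist (concat (map f (x # xs))) (concat (map f ys))"
        unfolding ys by (simp add: word_dist_distinct_blocks)
      moreover have "length (concat (map f xs)) = B * length xs"
        "length (concat (map f ys')) = B * length ys'"
        using Cons.prems ys by (auto intro!: length_concat_map)
      ultimately show ?thesis
        using ys by (intro exI[of _ 0]) (simp add: algebra_simps)
    qed
  qed
qed

text \<open>
  A page of \<open>K\<close> entries becomes a word of length \<open>4 K\<close>.  The common pages bounded by \<open>10 n / K\<close> cost at
  most \<open>80 n\<close> of the distance of two words, for every \<open>K\<close>, while each eventful digit contributes \<open>4 K\<close>.
  Since \<open>n\<close> digits have at least \<open>n\<close> eventful positions in two diaries together, any \<open>K > 40\<close> is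
  large enough; the value 80 leaves half of the contribution.
\<close>

definition journal :: "digit list \<Rightarrow> (digit \<times> bool) list list" where
  "journal = diary 80 (\<lambda>_. Zero) 0"

definition encode :: "digit list \<Rightarrow> bool list" where
  "encode ds = concat (map (\<lambda>p. concat (map letter_code p)) (journal ds))"

lemma length_page: "p \<in> set (diary K S h ds) \<Longrightarrow> length p = K"
  by (induction ds arbitrary: S h) (auto simp: page_def split: if_splits)

lemma encode_dist_le:
  assumes "neighbouring s t"
  shows "word_dist (encode (s @ v)) (encode (t @ v')) \<le> 320 * (length v + length v' + 2)"
proof -
  obtain p ds ds' where p: "journal (s @ v) = p @ ds" "journal (t @ v') = p @ ds'"
    and len: "length ds \<le> length v + 1" "length ds' \<le> length v' + 1"
    using neighbouring_common_pages[OF assms, of 80 "\<lambda>_. Zero" 0] unfolding journal_def by metis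
  let ?f = "\<lambda>p. concat (map letter_code p)"
  have f: "length (?f p) = 320" if "p \<in> set (journal xs)" for p xs
    using that length_page[of p 80 _ 0 xs] length_concat_map[of p letter_code 4]
    by (auto simp: journal_def length_letter_code)
  have "word_dist (encode (s @ v)) (encode (t @ v')) =
      word_dist (concat (map ?f ds)) (concat (map ?f ds'))"
    by (simp add: encode_def p word_dist_append)
  also have "\<dots> \<le> length (concat (map ?f ds)) + length (concat (map ?f ds'))"
    by (rule word_dist_le)
  also have "length (concat (map ?f ds)) = 320 * length ds"
    using f[of _ "s @ v"] p by (intro length_concat_map) simp
  also have "length (concat (map ?f ds')) = 320 * length ds'"
    using f[of _ "t @ v'"] p by (intro length_concat_map) simp
  finally show ?thesis
    using len by simp
qed

lemma encode_dist_ge: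
  assumes "neighbouring s t" "length s = length t"
    and len: "length v \<le> n" "length v' \<le> n"
    and div: "v = [] \<or> v' = [] \<or> s @ take 1 v \<noteq> t @ take 1 v'"
  shows "320 * (length (filter eventful v) + length (filter eventful v'))
    \<le> word_dist (encode (s @ v)) (encode (t @ v')) + 80 * n + 1320"
proof -
  let ?f = "\<lambda>p. concat (map letter_code p)"
  let ?xs = "journal (s @ v)" and ?ys = "journal (t @ v')"
  have len_page: "length p = 80" if "p \<in> set ?xs \<union> set ?ys" for p
    using that unfolding journal_def by (auto dest: length_page)
  have "\<forall>p\<in>set ?xs \<union> set ?ys. length (?f p) = 320"
    using len_page length_concat_map[of _ letter_code 4] by (simp add: length_letter_code)
  moreover have "inj_on ?f (set ?xs \<union> set ?ys)"
    using len_page concat_map_inj[OF inj_letter_code length_letter_code]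
    by (intro inj_onI) simp
  ultimately obtain q where q: "take q ?xs = take q ?ys" "q \<le> length ?xs" "q \<le> length ?ys"
    "320 * (length ?xs + length ?ys) \<le> word_dist (encode (s @ v)) (encode (t @ v')) + 2 * 320 * q + 2 * 320"
    unfolding encode_def using word_dist_concat_ge[of ?xs ?ys ?f 320] by blast
  have "80 * q \<le> 80 * min (length (filter eventful s)) (length (filter eventful t)) + 80 + 10 * n + 5"
    using q unfolding journal_def by (intro common_pages_bound[OF assms(1) len div assms(2)])
  then show ?thesis
    using q(4) by (simp add: journal_def length_diary)
qed

section \<open>Base-5 expansions\<close>

definition digit_of :: "int \<Rightarrow> digit" where
  "digit_of n = (if n mod 5 = 0 then Zero else if n mod 5 = 1 then One
     else if n mod 5 = 2 then Two else if n mod 5 = 3 then Three else Four)"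

definition expansion :: "real \<Rightarrow> nat \<Rightarrow> digit list" where
  "expansion x k = map (\<lambda>j. digit_of \<lfloor>5 ^ Suc j * x\<rfloor>) [0..<k]"

text \<open>
  The last \<open>k\<close> base-5 digits of an integer: the expansion of \<open>x\<close> as a function of the number of its interval.
\<close>

primrec digits :: "nat \<Rightarrow> int \<Rightarrow> digit list" where
  "digits 0 N = []"
| "digits (Suc k) N = digits k (N div 5) @ [digit_of N]"

lemma expansion_eq_digits: "expansion x k = digits k \<lfloor>5 ^ k * x\<rfloor>"
proof (induction k)
  case (Suc k)
  have "\<lfloor>5 ^ Suc k * x\<rfloor> div 5 = \<lfloor>5 ^ k * x\<rfloor>"
    using floor_divide_real_eq_div[of 5 "5 ^ Suc k * x"] by simp
  with Suc show ?case
    by (simp add: expansion_def)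
qed (simp add: expansion_def)

lemma digit_of_add: "digit_of (n + 5 * t) = digit_of n"
  by (simp add: digit_of_def)

lemma digit_of_cases:
  "n mod 5 = 0 \<and> digit_of n = Zero \<or> n mod 5 = 1 \<and> digit_of n = One \<or> n mod 5 = 2 \<and> digit_of n = Two \<or>
   n mod 5 = 3 \<and> digit_of n = Three \<or> n mod 5 = 4 \<and> digit_of n = Four"
proof -
  have "0 \<le> n mod 5" "n mod 5 < 5"
    by simp_all
  then show ?thesis
    unfolding digit_of_def by auto
qed

lemma digit_of_eq_iff: "digit_of a = digit_of b \<longleftrightarrow> a mod 5 = b mod 5"
  using digit_of_cases[of a] digit_of_cases[of b] by (elim disjE conjE) simp_all

lemma eventful_digit_of: "eventful (digit_of a) \<longleftrightarrow> a mod 5 \<noteq> 0 \<and> a mod 5 \<noteq> 4"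
  using digit_of_cases[of a] by (elim disjE conjE) (simp_all add: eventful_def)

lemma digits_successor:
  "digits m N = replicate m Four \<and> digits m (N + 1) = replicate m Zero \<or>
   (\<exists>c d d' r. d \<noteq> d' \<and> (eventful d \<or> eventful d') \<and>
      digits m N = c @ d # replicate r Four \<and> digits m (N + 1) = c @ d' # replicate r Zero)"
proof (induction m arbitrary: N)
  case (Suc m)
  show ?case
  proof (cases "N mod 5 = 4")
    case True
    then have N: "(N + 1) div 5 = N div 5 + 1" "(N + 1) mod 5 = 0"
      by presburger+
    then have d: "digit_of N = Four" "digit_of (N + 1) = Zero"
      using True by (simp_all add: digit_of_def)
    consider "digits m (N div 5) = replicate m Four" "digits m (N div 5 + 1) = replicate m Zero"
      | c d e r where "d \<noteq> e" "eventful d \<or> eventful e"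
        "digits m (N div 5) = c @ d # replicate r Four"
        "digits m (N div 5 + 1) = c @ e # replicate r Zero"
      using Suc[of "N div 5"] by blast
    then show ?thesis
    proof cases
      case 1
      then show ?thesis
        using d N by (simp add: replicate_append_same)
    next
      case 2
      then show ?thesis
        using d N by (intro disjI2 exI[of _ c] exI[of _ d] exI[of _ e] exI[of _ "Suc r"])
          (simp add: replicate_append_same)
    qed
  next
    case False
    then have N: "(N + 1) div 5 = N div 5" "(N + 1) mod 5 = N mod 5 + 1"
      by presburger+
    then have "digit_of N \<noteq> digit_of (N + 1)" "eventful (digit_of N) \<or> eventful (digit_of (N + 1))"
      unfolding digit_of_eq_iff eventful_digit_of by presburger+
    then show ?thesis
      using N by (intro disjI2 exI[of _ "digits m (N div 5)"] exI[of _ "digit_of N"]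
          exI[of _ "digit_of (N + 1)"] exI[of _ 0]) auto
  qed
qed simp

lemma neighbouring_digits:
  assumes "\<bar>M - N\<bar> \<le> 1"
  shows "neighbouring (digits m M) (digits m N)"
proof -
  have quiet: "\<not> eventful Four" "\<not> eventful Zero"
    by (simp_all add: eventful_def)
  have *: "neighbouring (digits m N) (digits m (N + 1))" for N
    using digits_successor[of m N] quiet
    by (elim disjE exE conjE) (simp_all add: neighbouring.wrap neighbouring.carry)
  consider "M = N" | "M = N + 1" | "N = M + 1"
    using assms by linarith
  then show ?thesis
    by cases (auto intro: * neighbouring_sym neighbouring.same)
qed

lemma digits_eq_imp_cong: "digits m M = digits m N \<Longrightarrow> M mod 5 ^ m = N mod 5 ^ m"
proof (induction m arbitrary: M N)
  case (Suc m)
  have "digits m (M div 5) = digits m (N div 5)" "digit_of M = digit_of N"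
    using Suc.prems by auto
  moreover have "M mod 5 = N mod 5"
    using calculation(2) by (simp add: digit_of_eq_iff)
  moreover have "(M div 5) mod 5 ^ m = (N div 5) mod 5 ^ m"
    using calculation(1) by (rule Suc.IH)
  ultimately show ?case
    by (simp add: zmod_zmult2_eq)
qed simp

lemma length_expansion [simp]: "length (expansion x k) = k"
  by (simp add: expansion_def)

lemma expansion_split:
  "m \<le> k \<Longrightarrow> expansion x k = expansion x m @ map (\<lambda>j. digit_of \<lfloor>5 ^ Suc j * x\<rfloor>) [m..<k]"
  unfolding expansion_def using upt_add_eq_append[of 0 m "k - m"] by simp

lemma expansion_periodic: "expansion (x + of_int t) k = expansion x k"
proof -
  have "digit_of \<lfloor>5 ^ Suc j * (x + of_int t)\<rfloor> = digit_of \<lfloor>5 ^ Suc j * x\<rfloor>" for j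
  proof -
    have "5 ^ Suc j * (x + of_int t) = 5 ^ Suc j * x + of_int (5 ^ Suc j * t)"
      by (simp add: algebra_simps)
    then have "\<lfloor>5 ^ Suc j * (x + of_int t)\<rfloor> = \<lfloor>5 ^ Suc j * x\<rfloor> + 5 ^ Suc j * t"
      by (simp only: floor_add_int)
    moreover have "5 ^ Suc j * t = 5 * (5 ^ j * t)"
      by simp
    ultimately show ?thesis
      by (simp only: digit_of_add)
  qed
  then show ?thesis
    by (simp add: expansion_def)
qed

lemma neighbouring_expansion:
  assumes "\<bar>x - y\<bar> \<le> 1 / 5 ^ m"
  shows "neighbouring (expansion x m) (expansion y m)"
proof -
  have "\<bar>5 ^ m * x - 5 ^ m * y\<bar> = 5 ^ m * \<bar>x - y\<bar>"
    by (simp add: abs_mult right_diff_distrib[symmetric])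
  also have "\<dots> \<le> 1"
    using assms by (simp add: field_simps)
  finally have "\<bar>\<lfloor>5 ^ m * x\<rfloor> - \<lfloor>5 ^ m * y\<rfloor>\<bar> \<le> 1"
    by linarith
  then show ?thesis
    unfolding expansion_eq_digits by (rule neighbouring_digits)
qed

lemma expansion_neq:
  assumes "1 / 5 ^ Suc m < \<bar>x - y\<bar>" "\<bar>x - y\<bar> \<le> 1 / 2"
  shows "expansion x (Suc m) \<noteq> expansion y (Suc m)"
proof
  let ?M = "\<lfloor>5 ^ Suc m * x\<rfloor>" and ?N = "\<lfloor>5 ^ Suc m * y\<rfloor>"
  assume "expansion x (Suc m) = expansion y (Suc m)"
  then have "?M mod 5 ^ Suc m = ?N mod 5 ^ Suc m"
    unfolding expansion_eq_digits by (rule digits_eq_imp_cong)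
  then have dvd: "5 ^ Suc m dvd ?M - ?N"
    by (simp only: mod_eq_dvd_iff)
  have *: "\<bar>5 ^ Suc m * x - 5 ^ Suc m * y\<bar> = 5 ^ Suc m * \<bar>x - y\<bar>"
    by (simp add: abs_mult right_diff_distrib[symmetric])
  have "5 ^ Suc m * \<bar>x - y\<bar> \<le> 5 ^ Suc m * (1 / 2)"
    using assms by (intro mult_left_mono) auto
  then have "real_of_int \<bar>?M - ?N\<bar> < 5 ^ Suc m / 2 + 1"
    using * by linarith
  also have "\<dots> < 5 ^ Suc m"
    using one_le_power[of "5::real" m] unfolding power_Suc by linarith
  finally have "\<bar>?M - ?N\<bar> < 5 ^ Suc m"
    by (metis of_int_less_iff of_int_numeral of_int_power)
  with dvd have "\<not> 0 < \<bar>?M - ?N\<bar>"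
    using zdvd_imp_le[of "5 ^ Suc m" "\<bar>?M - ?N\<bar>"] by (metis dvd_abs_iff not_less)
  then have "?M = ?N"
    by simp
  then have "5 ^ Suc m * \<bar>x - y\<bar> < 1"
    using * by linarith
  then show False
    using assms(1) by (simp add: field_simps)
qed

text \<open>
  As \<open>5^j\<close> is odd, adding \<open>1 / 2\<close> changes the digit at position \<open>j\<close> by 2 or 3 modulo 5, which takes
  0 and 4 to 1, 2 or 3.
\<close>

lemma eventful_shift:
  fixes x :: real
  shows "eventful (digit_of \<lfloor>5 ^ Suc j * x\<rfloor>) \<or> eventful (digit_of \<lfloor>5 ^ Suc j * (x + 1 / 2)\<rfloor>)"
proof -
  have "odd ((5::int) ^ j)"
    by simp
  then obtain t where t: "(5::int) ^ j = 2 * t + 1"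
    by (rule oddE)
  have "real_of_int (5 ^ j) = of_int (2 * t + 1)"
    by (simp only: t)
  then have "5 ^ Suc j * (x + 1 / 2) = (5 ^ Suc j * x + 1 / 2) + of_int (5 * t + 2)"
    by (simp add: algebra_simps)
  then have s: "\<lfloor>5 ^ Suc j * (x + 1 / 2)\<rfloor> = \<lfloor>5 ^ Suc j * x + 1 / 2\<rfloor> + (5 * t + 2)"
    by (simp only: floor_add_int)
  define N where "N = \<lfloor>5 ^ Suc j * x\<rfloor>"
  have "\<lfloor>5 ^ Suc j * x + 1 / 2\<rfloor> = N \<or> \<lfloor>5 ^ Suc j * x + 1 / 2\<rfloor> = N + 1"
    unfolding N_def by linarith
  then have "\<lfloor>5 ^ Suc j * (x + 1 / 2)\<rfloor> = N + 2 + 5 * t \<or> \<lfloor>5 ^ Suc j * (x + 1 / 2)\<rfloor> = N + 3 + 5 * t"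
    using s by auto
  moreover have "eventful (digit_of N) \<or> eventful (digit_of (N + 2))"
    "eventful (digit_of N) \<or> eventful (digit_of (N + 3))"
    unfolding eventful_digit_of by presburger+
  ultimately show ?thesis
    unfolding N_def[symmetric] using digit_of_add[of "N + 2" t] digit_of_add[of "N + 3" t] by metis
qed

lemma eventful_digits_count:
  assumes "\<And>j. eventful (f j) \<or> eventful (g j)"
  shows "k - m \<le> length (filter eventful (map f [m..<k])) + length (filter eventful (map g [m..<k]))"
proof (induction k)
  case (Suc k)
  then show ?case
    using assms[of k] by (cases "m \<le> k") auto
qed simp

section \<open>Words for points given by angle and level\<close>

definition address :: "real \<Rightarrow> nat \<Rightarrow> bool list" where
  "address x k = encode (expansion x k)"

lemma address_dist_le:
  assumes "\<bar>x - y\<bar> \<le> 1 / 5 ^ m" "m \<le> k" "m \<le> l"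
  shows "word_dist (address x k) (address y l) \<le> 320 * ((k - m) + (l - m) + 2)"
  using encode_dist_le[OF neighbouring_expansion[OF assms(1)],
      of "map (\<lambda>j. digit_of \<lfloor>5 ^ Suc j * x\<rfloor>) [m..<k]" "map (\<lambda>j. digit_of \<lfloor>5 ^ Suc j * y\<rfloor>) [m..<l]"]
  unfolding address_def expansion_split[OF assms(2)] expansion_split[OF assms(3)]
  by (simp only: length_map length_upt)

lemma address_dist_ge:
  assumes xy: "\<bar>x - y\<bar> \<le> 1 / 5 ^ m" and m: "m \<le> k" "m \<le> l"
    and div: "m = k \<or> m = l \<or> 1 / 5 ^ Suc m < \<bar>x - y\<bar> \<and> \<bar>x - y\<bar> \<le> 1 / 2"
    and n: "k - m \<le> n" "l - m \<le> n"
  shows "320 * (length (filter eventful (map (\<lambda>j. digit_of \<lfloor>5 ^ Suc j * x\<rfloor>) [m..<k])) +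
      length (filter eventful (map (\<lambda>j. digit_of \<lfloor>5 ^ Suc j * y\<rfloor>) [m..<l])))
    \<le> word_dist (address x k) (address y l) + 80 * n + 1320"
  unfolding address_def expansion_split[OF m(1)] expansion_split[OF m(2)]
proof (rule encode_dist_ge[OF neighbouring_expansion[OF xy]])
  let ?f = "\<lambda>x j. digit_of \<lfloor>5 ^ Suc j * x\<rfloor>"
  show "map (?f x) [m..<k] = [] \<or> map (?f y) [m..<l] = [] \<or>
      expansion x m @ take 1 (map (?f x) [m..<k]) \<noteq> expansion y m @ take 1 (map (?f y) [m..<l])"
  proof (cases "m = k \<or> m = l")
    case True
    then have "[m..<k] = [] \<or> [m..<l] = []"
      by auto
    then show ?thesis
      by blast
  next
    case False
    then have "take 1 (map (?f x) [m..<k]) = [?f x m]" "take 1 (map (?f y) [m..<l]) = [?f y m]"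
      using m by (simp_all add: upt_conv_Cons)
    moreover have "expansion x (Suc m) \<noteq> expansion y (Suc m)"
      using False div expansion_neq by blast
    ultimately show ?thesis
      by (simp add: expansion_split[of m "Suc m"])
  qed
qed (use n in simp_all)

text \<open>
  Here \<open>m\<close> is the level at which the coarse geodesic turns: the intervals of level \<open>m\<close> are adjacent or equal,
  and either those of level \<open>m + 1\<close> are different or one of the points has level \<open>m\<close>.
\<close>

lemma address_pair_dist_ge:
  assumes xy: "\<bar>x - y\<bar> \<le> 1 / 5 ^ m" and m: "m \<le> k" "m \<le> l"
    and div: "m = k \<or> m = l \<or> 1 / 5 ^ Suc m < \<bar>x - y\<bar> \<and> \<bar>x - y\<bar> \<le> 1 / 2"
  shows "80 * ((k - m) + (l - m)) \<le> word_dist (address x k) (address y l) +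
      word_dist (address (x + 1 / 2) k) (address (y + 1 / 2) l) + 2640"
proof -
  define n where "n = max (k - m) (l - m)"
  define count where
    "count = (\<lambda>(x::real) k. length (filter eventful (map (\<lambda>j. digit_of \<lfloor>5 ^ Suc j * x\<rfloor>) [m..<k])))"
  have n: "k - m \<le> n" "l - m \<le> n"
    by (simp_all add: n_def)
  have "320 * (count x k + count y l) \<le> word_dist (address x k) (address y l) + 80 * n + 1320"
    unfolding count_def by (rule address_dist_ge[OF assms n])
  moreover have "320 * (count (x + 1 / 2) k + count (y + 1 / 2) l) \<le>
      word_dist (address (x + 1 / 2) k) (address (y + 1 / 2) l) + 80 * n + 1320"
    unfolding count_def by (rule address_dist_ge) (use assms n in simp_all)
  moreover have "k - m \<le> count x k + count (x + 1 / 2) k" "l - m \<le> count y l + count (y + 1 / 2) l"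
    unfolding count_def by (rule eventful_digits_count, rule eventful_shift)+
  then have "n \<le> count x k + count (x + 1 / 2) k + (count y l + count (y + 1 / 2) l)"
    by (simp add: n_def)
  ultimately show ?thesis
    using n by (simp add: algebra_simps)
qed



section \<open>Polar coordinates in the hyperbolic plane\<close>

text \<open>
  Polar coordinates about \<open>\<i>\<close>, with angle \<open>2 pi x\<close>.  The three quotients are the coordinates of \<open>z\<close> in the
  hyperboloid model.
\<close>

definition polar :: "complex \<Rightarrow> real \<Rightarrow> real \<Rightarrow> bool" where
  "polar z r x \<longleftrightarrow> 0 \<le> r \<and> (1 + (cmod z)\<^sup>2) / (2 * Im z) = cosh r \<and>
     ((cmod z)\<^sup>2 - 1) / (2 * Im z) = sinh r * cos (2 * pi * x) \<and>
     Re z / Im z = sinh r * sin (2 * pi * x)"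

lemma polar_exists:
  assumes "0 < Im z"
  shows "\<exists>r x. polar z r x"
proof -
  define A B C where "A = (1 + (cmod z)\<^sup>2) / (2 * Im z)"
    and "B = ((cmod z)\<^sup>2 - 1) / (2 * Im z)" and "C = Re z / Im z"
  have ABC: "B\<^sup>2 + C\<^sup>2 = A\<^sup>2 - 1"
    using assms unfolding A_def B_def C_def cmod_power2 by (simp add: field_simps power2_eq_square)
  have "0 \<le> (Re z)\<^sup>2 + (Im z - 1)\<^sup>2"
    by simp
  then have "2 * Im z \<le> 1 + (cmod z)\<^sup>2"
    unfolding cmod_power2 by (simp add: power2_eq_square algebra_simps)
  then have "1 \<le> A"
    using assms by (simp add: A_def field_simps)
  define r where "r = arcosh A"
  have r: "0 \<le> r" "cosh r = A"
    using \<open>1 \<le> A\<close> by (simp_all add: r_def)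
  have BC: "B\<^sup>2 + C\<^sup>2 = (sinh r)\<^sup>2"
    using ABC unfolding r(2)[symmetric] by (simp add: cosh_square_eq)
  obtain x where "B = sinh r * cos (2 * pi * x)" "C = sinh r * sin (2 * pi * x)"
  proof (cases "sinh r = 0")
    case True
    with BC have "B = 0" "C = 0"
      by (simp_all add: sum_power2_eq_zero_iff)
    with True that[of 0] show ?thesis
      by simp
  next
    case False
    then have "(B / sinh r)\<^sup>2 + (C / sinh r)\<^sup>2 = 1"
      using BC by (simp add: power_divide add_divide_distrib[symmetric])
    then obtain t where "B / sinh r = cos t" "C / sinh r = sin t"
      using sincos_total_2pi by metis
    then show ?thesis
      using False by (intro that[of "t / (2 * pi)"]) (simp_all add: field_simps)
  qed
  with r have "polar z r x"
    by (simp add: polar_def A_def B_def C_def)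
  then show ?thesis
    by blast
qed

lemma polar_shift:
  assumes "polar z r x"
  shows "polar z r (x + of_int t)"
proof -
  have "2 * pi * (x + of_int t) = 2 * pi * x + 2 * pi * of_int t"
    by (simp add: algebra_simps)
  then show ?thesis
    using assms by (simp add: polar_def sin_add cos_add)
qed

text \<open>
  The hyperbolic law of cosines; in the hyperboloid model the left-hand side is, up to sign, the
  Lorentz product of the two points.
\<close>

lemma cosh_hyp_dist_polar:
  assumes z: "0 < Im z" "polar z r x" and w: "0 < Im w" "polar w s y"
  shows "cosh (hyp_dist z w) = cosh (r - s) + 2 * sinh r * sinh s * (sin (pi * (x - y)))\<^sup>2"
proof -
  have "0 \<le> (cmod (z - w))\<^sup>2 / (2 * Im z * Im w)"
    using z w by simp
  then have "cosh (hyp_dist z w) = 1 + (cmod (z - w))\<^sup>2 / (2 * Im z * Im w)"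
    unfolding hyp_dist_def by (intro cosh_arcosh_real) simp
  also have "\<dots> = (1 + (cmod z)\<^sup>2) / (2 * Im z) * ((1 + (cmod w)\<^sup>2) / (2 * Im w)) -
      ((cmod z)\<^sup>2 - 1) / (2 * Im z) * (((cmod w)\<^sup>2 - 1) / (2 * Im w)) -
      Re z / Im z * (Re w / Im w)"
    using z(1) w(1) unfolding cmod_power2 by (simp add: field_simps power2_eq_square)
  also have "\<dots> = cosh r * cosh s - sinh r * cos (2 * pi * x) * (sinh s * cos (2 * pi * y)) -
      sinh r * sin (2 * pi * x) * (sinh s * sin (2 * pi * y))"
    using z(2) w(2) by (simp add: polar_def)
  also have "\<dots> = cosh r * cosh s - sinh r * sinh s * cos (2 * pi * x - 2 * pi * y)"
    by (simp add: cos_diff algebra_simps)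
  also have "2 * pi * x - 2 * pi * y = 2 * (pi * (x - y))"
    by (simp add: algebra_simps)
  finally show ?thesis
    unfolding cos_double_sin by (simp add: cosh_diff algebra_simps)
qed

lemma hyp_dist_nonneg: "0 < Im z \<Longrightarrow> 0 < Im w \<Longrightarrow> 0 \<le> hyp_dist z w"
  by (simp add: hyp_dist_def)

lemma cosh_real_bounds:
  fixes d :: real
  shows "0 \<le> d \<Longrightarrow> cosh d \<le> exp d" "exp d \<le> 2 * cosh d"
proof -
  have d: "cosh d = (exp d + exp (- d)) / 2"
    by (simp add: cosh_def)
  show "exp d \<le> 2 * cosh d"
    by (simp add: d)
  show "cosh d \<le> exp d" if "0 \<le> d"
    using that by (simp add: d)
qed

lemma hyp_dist_polar_le:
  assumes z: "0 < Im z" "polar z r x" and w: "0 < Im w" "polar w s y"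
    and m: "real m * ln 5 \<le> r" "real m * ln 5 \<le> s" and xy: "\<bar>x - y\<bar> \<le> 1 / 5 ^ m"
  shows "hyp_dist z w \<le> r + s - 2 * real m * ln 5 + 17"
proof -
  define L where "L = r + s - 2 * real m * ln 5"
  have pow: "exp (real m * ln 5) = (5::real) ^ m"
    by (simp add: exp_of_nat_mult)
  have rs: "0 \<le> r" "0 \<le> s"
    using z w by (auto simp: polar_def)
  have "\<bar>sin (pi * (x - y))\<bar> \<le> \<bar>pi * (x - y)\<bar>"
    by (rule abs_sin_x_le_abs_x)
  also have "\<dots> \<le> 4 * (1 / 5 ^ m)"
    unfolding abs_mult using xy pi_less_4 by (intro mult_mono) auto
  finally have "(sin (pi * (x - y)))\<^sup>2 \<le> (4 * (1 / 5 ^ m))\<^sup>2"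
    by (metis abs_ge_zero power2_abs power_mono)
  also have "\<dots> = 16 * exp (- (2 * real m * ln 5))"
    by (simp add: pow[symmetric] exp_minus power2_eq_square exp_add[symmetric] field_simps)
  finally have s2: "(sin (pi * (x - y)))\<^sup>2 \<le> 16 * exp (- (2 * real m * ln 5))" .
  have sh: "0 \<le> sinh t" "sinh t \<le> exp t / 2" if "0 \<le> t" for t :: real
    using that by (simp_all add: sinh_def)
  have "2 * sinh r * sinh s * (sin (pi * (x - y)))\<^sup>2 \<le>
      2 * (exp r / 2) * (exp s / 2) * (16 * exp (- (2 * real m * ln 5)))"
    using sh rs s2 by (intro mult_mono) auto
  also have "\<dots> = 8 * exp L"
    by (simp add: L_def exp_add exp_diff exp_minus field_simps)
  finally have "2 * sinh r * sinh s * (sin (pi * (x - y)))\<^sup>2 \<le> 8 * exp L" .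
  moreover have "cosh (r - s) \<le> exp L"
  proof -
    have "\<bar>r - s\<bar> \<le> L"
      using m unfolding L_def by linarith
    then have "cosh \<bar>r - s\<bar> \<le> exp L"
      using cosh_real_bounds(1)[of "\<bar>r - s\<bar>"] by (meson abs_ge_zero exp_le_cancel_iff order_trans)
    then show ?thesis
      by simp
  qed
  ultimately have "cosh (hyp_dist z w) \<le> 9 * exp L"
    unfolding cosh_hyp_dist_polar[OF z w] by simp
  then have "exp (hyp_dist z w) \<le> 18 * exp L"
    using cosh_real_bounds(2)[of "hyp_dist z w"] by simp
  also have "\<dots> \<le> exp 17 * exp L"
    using exp_ge_add_one_self[of 17] by simp
  finally show ?thesis
    by (simp add: L_def exp_add[symmetric])
qed

lemma hyp_dist_ge_radii:
  assumes z: "0 < Im z" "polar z r x" and w: "0 < Im w" "polar w s y"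
  shows "\<bar>r - s\<bar> \<le> hyp_dist z w"
proof -
  have "0 \<le> sinh r" "0 \<le> sinh s"
    using z w by (auto simp: polar_def)
  then have "cosh \<bar>r - s\<bar> \<le> cosh (hyp_dist z w)"
    unfolding cosh_hyp_dist_polar[OF z w] by simp
  then show ?thesis
    using hyp_dist_nonneg[OF z(1) w(1)] by (subst (asm) cosh_real_nonneg_le_iff) auto
qed

text \<open>A weak form of Jordan's inequality, by the mean value theorem for small \<open>t\<close> and monotonicity otherwise.\<close>

lemma sin_ge_chord:
  assumes "0 \<le> t" "t \<le> 1 / 2"
  shows "t \<le> sin (pi * t)"
proof (cases "t \<le> 1 / 6")
  case True
  show ?thesis
  proof (cases "t = 0")
    case False
    have "\<exists>u>0. u < pi * t \<and> sin (pi * t) - sin 0 = (pi * t - 0) * cos u"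
      using assms False by (intro MVT2) (auto intro: DERIV_sin)
    then obtain u where u: "0 < u" "u < pi * t" "sin (pi * t) = pi * t * cos u"
      by auto
    have "pi * t \<le> pi * (1 / 6)"
      using True by (intro mult_left_mono) auto
    then have "u \<le> pi / 3"
      using u(2) pi_gt_zero by linarith
    then have "cos (pi / 3) \<le> cos u"
      using u(1) by (intro cos_monotone_0_pi_le) auto
    then have "1 / 2 \<le> cos u"
      by (simp add: cos_60)
    moreover have "2 * t \<le> pi * t"
      using assms pi_ge_two by (intro mult_right_mono) auto
    ultimately have "2 * t * (1 / 2) \<le> pi * t * cos u"
      using assms pi_ge_two by (intro mult_mono) auto
    then show ?thesis
      by (simp add: u(3))
  qed simp
next
  case False
  have "pi / 6 \<le> pi * t" "pi * t \<le> pi / 2"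
    using False assms by (simp_all add: field_simps)
  then have "sin (pi / 6) \<le> sin (pi * t)"
    by (intro sin_monotone_2pi_le) (use pi_gt_zero in linarith)+
  then show ?thesis
    using assms by (simp add: sin_30)
qed

lemma hyp_dist_polar_ge:
  assumes z: "0 < Im z" "polar z r x" and w: "0 < Im w" "polar w s y"
    and rs: "ln 5 \<le> r" "ln 5 \<le> s"
    and xy: "1 / 5 ^ Suc m < \<bar>x - y\<bar>" "\<bar>x - y\<bar> \<le> 1 / 2"
  shows "r + s - 2 * real m * ln 5 - 200 \<le> hyp_dist z w"
proof -
  define L where "L = r + s - 2 * real m * ln 5"
  have pow: "exp (real m * ln 5) = (5::real) ^ m"
    by (simp add: exp_of_nat_mult)
  have "1 / 5 ^ Suc m \<le> sin (pi * \<bar>x - y\<bar>)"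
    using sin_ge_chord[of "\<bar>x - y\<bar>"] xy by simp
  also have "\<dots> \<le> \<bar>sin (pi * (x - y))\<bar>"
    by (cases "x \<le> y") (simp_all add: abs_if algebra_simps sin_diff)
  finally have "(1 / 5 ^ Suc m)\<^sup>2 \<le> (sin (pi * (x - y)))\<^sup>2"
    by (metis power2_abs power_mono zero_le_divide_1_iff zero_le_numeral zero_le_power)
  moreover have "(1 / 5 ^ Suc m)\<^sup>2 = exp (- (2 * real m * ln 5)) / 25"
    by (simp add: pow[symmetric] exp_minus power2_eq_square exp_add[symmetric] field_simps)
  ultimately have s2: "exp (- (2 * real m * ln 5)) / 25 \<le> (sin (pi * (x - y)))\<^sup>2"
    by simp
  have sh: "exp t / 4 \<le> sinh t" if "ln 5 \<le> t" for t :: real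
  proof -
    have "5 \<le> exp t"
      using that by (metis exp_le_cancel_iff exp_ln zero_less_numeral)
    then have "inverse (exp t) \<le> inverse 5"
      by (rule le_imp_inverse_le) simp
    with \<open>5 \<le> exp t\<close> show ?thesis
      by (simp add: sinh_def exp_minus)
  qed
  have pos: "0 \<le> sinh r" "0 \<le> sinh s"
    using z w by (simp_all add: polar_def)
  have "2 * (exp r / 4) * (exp s / 4) * (exp (- (2 * real m * ln 5)) / 25) \<le>
      2 * sinh r * sinh s * (sin (pi * (x - y)))\<^sup>2"
    using sh[OF rs(1)] sh[OF rs(2)] s2 pos by (intro mult_mono) simp_all
  also have "\<dots> \<le> cosh (hyp_dist z w)"
    unfolding cosh_hyp_dist_polar[OF z w] by simp
  also have "\<dots> \<le> exp (hyp_dist z w)"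
    using cosh_real_bounds(1)[of "hyp_dist z w"] hyp_dist_nonneg[OF z(1) w(1)] by simp
  finally have "exp L / 200 \<le> exp (hyp_dist z w)"
    by (simp add: L_def exp_add exp_diff exp_minus field_simps)
  then have "exp L \<le> 200 * exp (hyp_dist z w)"
    by simp
  also have "\<dots> \<le> exp 200 * exp (hyp_dist z w)"
    using exp_ge_add_one_self[of 200] by simp
  finally show ?thesis
    by (simp add: L_def exp_add[symmetric])
qed

section \<open>The embedding\<close>

lemma ln_5_bounds: "1 \<le> ln (5::real)" "ln (5::real) \<le> 2"
proof -
  have "exp 1 \<le> (5::real)"
    using exp_le by simp
  then show "1 \<le> ln (5::real)"
    by (simp add: ln_ge_iff)
  have "(5::real) \<le> exp 2"
    using exp_lower_Taylor_quadratic[of 2] by simp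
  then have "ln (5::real) \<le> ln (exp 2)"
    by (subst ln_le_cancel_iff) auto
  then show "ln (5::real) \<le> 2"
    by simp
qed

text \<open>
  The number \<open>m\<close> below is the level at which the coarse geodesic turns.  Both distances are
  compared with \<open>P = (k - m) + (l - m)\<close>, the number of levels it passes; the level \<open>k\<close> stands for
  radii between \<open>k ln 5\<close> and \<open>(k + 1) ln 5\<close>.
\<close>

lemma hyp_dist_address_pair_dist:
  assumes z: "0 < Im z" "polar z r x" and w: "0 < Im w" "polar w s y"
    and k: "real k * ln 5 \<le> r" "r \<le> (real k + 1) * ln 5"
    and l: "real l * ln 5 \<le> s" "s \<le> (real l + 1) * ln 5"
    and xy: "\<bar>x - y\<bar> \<le> 1 / 2"
    and D: "D = real (word_dist (address x k) (address y l) +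
      word_dist (address (x + 1 / 2) k) (address (y + 1 / 2) l))"
  shows "hyp_dist z w / 640 - 200000 \<le> D" "D \<le> 640 * hyp_dist z w + 200000"
proof -
  define M where "M = {j. j \<le> min k l \<and> \<bar>x - y\<bar> \<le> 1 / 5 ^ j}"
  define m where "m = Max M"
  have M: "finite M" "0 \<in> M"
    using xy by (auto simp: M_def)
  then have "m \<in> M"
    unfolding m_def by (intro Max_in) auto
  then have m: "m \<le> k" "m \<le> l" "\<bar>x - y\<bar> \<le> 1 / 5 ^ m"
    by (auto simp: M_def)
  have div: "m = k \<or> m = l \<or> 1 / 5 ^ Suc m < \<bar>x - y\<bar>"
  proof (rule ccontr)
    assume "\<not> ?thesis"
    with m have "Suc m \<in> M"
      by (auto simp: M_def)
    then show False
      using Max_ge[OF M(1)] by (fastforce simp: m_def)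
  qed
  define P where "P = real (k - m) + real (l - m)"
  define L where "L = r + s - 2 * real m * ln 5"
  have lower: "80 * P \<le> D + 2640"
  proof -
    have "80 * ((k - m) + (l - m)) \<le> word_dist (address x k) (address y l) +
        word_dist (address (x + 1 / 2) k) (address (y + 1 / 2) l) + 2640"
      using address_pair_dist_ge[OF m(3,1,2)] div xy by blast
    then have "real (80 * ((k - m) + (l - m))) \<le> real (word_dist (address x k) (address y l) +
        word_dist (address (x + 1 / 2) k) (address (y + 1 / 2) l) + 2640)"
      by (simp only: of_nat_le_iff)
    then show ?thesis
      by (simp add: D P_def)
  qed
  have upper: "D \<le> 640 * P + 1280"
  proof -
    have "word_dist (address x k) (address y l) \<le> 320 * ((k - m) + (l - m) + 2)"
      by (rule address_dist_le[OF m(3,1,2)])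
    moreover have "word_dist (address (x + 1 / 2) k) (address (y + 1 / 2) l) \<le>
        320 * ((k - m) + (l - m) + 2)"
      by (rule address_dist_le) (use m in simp_all)
    ultimately have "real (word_dist (address x k) (address y l) +
        word_dist (address (x + 1 / 2) k) (address (y + 1 / 2) l)) \<le>
        real (640 * ((k - m) + (l - m) + 2))"
      unfolding of_nat_le_iff by linarith
    then show ?thesis
      by (simp add: D P_def)
  qed
  have P: "P = real k + real l - 2 * real m"
    using m by (simp add: P_def of_nat_diff)
  have L: "P * ln 5 \<le> L" "L \<le> (P + 2) * ln 5"
    using k l by (simp_all add: P L_def algebra_simps)
  have "real m * ln 5 \<le> real k * ln 5" "real m * ln 5 \<le> real l * ln 5"
    using m by auto
  then have mr: "real m * ln 5 \<le> r" "real m * ln 5 \<le> s"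
    using k l by linarith+
  have "hyp_dist z w \<le> L + 17"
    unfolding L_def by (rule hyp_dist_polar_le[OF z w mr m(3)])
  moreover have "L - 200 \<le> hyp_dist z w"
  proof (cases "m = k \<or> m = l")
    case True
    \<comment> \<open>One of the points is near the turning point, so the geodesic is almost radial.\<close>
    then have "L \<le> \<bar>r - s\<bar> + 2 * ln 5"
      using k l by (auto simp: L_def algebra_simps)
    then show ?thesis
      using hyp_dist_ge_radii[OF z w] ln_5_bounds by linarith
  next
    case False
    then have "1 * ln 5 \<le> real k * ln 5" "1 * ln 5 \<le> real l * ln 5"
      using m by (intro mult_right_mono; simp)+
    then have "ln 5 \<le> r" "ln 5 \<le> s"
      using k l by linarith+
    then show ?thesis
      unfolding L_def using False div xy by (intro hyp_dist_polar_ge[OF z w]) auto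
  qed
  moreover have P0: "0 \<le> P"
    by (simp add: P_def)
  then have "P * 1 \<le> P * ln 5" "(P + 2) * ln 5 \<le> (P + 2) * 2"
    using ln_5_bounds by (intro mult_left_mono; simp)+
  then have "P \<le> L" "L \<le> 2 * P + 4"
    using L by simp_all
  ultimately show "hyp_dist z w / 640 - 200000 \<le> D" "D \<le> 640 * hyp_dist z w + 200000"
    using lower upper P0 by linarith+
qed

theorem corollary1p2:
  shows "\<exists>f. quasiisometric_embedding hyperbolic_plane (l1_prod_metric binary_tree binary_tree) f"
proof -
  obtain R X where polar: "\<And>z. 0 < Im z \<Longrightarrow> polar z (R z) (X z)"
    using polar_exists by metis
  define k where "k = (\<lambda>z. nat \<lfloor>R z / ln 5\<rfloor>)"
  define f where "f = (\<lambda>z. (vertex (address (X z) (k z)), vertex (address (X z + 1 / 2) (k z))))"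
  have k: "real (k z) * ln 5 \<le> R z" "R z \<le> (real (k z) + 1) * ln 5" if "0 < Im z" for z
  proof -
    have "0 \<le> R z / ln 5"
      using polar[OF that] by (simp add: polar_def)
    then have "real (k z) \<le> R z / ln 5" "R z / ln 5 \<le> real (k z) + 1"
      unfolding k_def by linarith+
    then show "real (k z) * ln 5 \<le> R z" "R z \<le> (real (k z) + 1) * ln 5"
      by (simp_all add: field_simps)
  qed
  have "quasiisometric_embedding hyperbolic_plane (l1_prod_metric binary_tree binary_tree) f"
    unfolding quasiisometric_embedding_def
  proof (rule conjI)
    show "f \<in> mspace hyperbolic_plane \<rightarrow> mspace (l1_prod_metric binary_tree binary_tree)"
      by (auto simp: f_def)
    show "\<exists>a b. 1 \<le> a \<and> 0 \<le> b \<and> (\<forall>z\<in>mspace hyperbolic_plane. \<forall>w\<in>mspace hyperbolic_plane.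
        mdist hyperbolic_plane z w / a - b \<le> mdist (l1_prod_metric binary_tree binary_tree) (f z) (f w) \<and>
        mdist (l1_prod_metric binary_tree binary_tree) (f z) (f w) \<le> a * mdist hyperbolic_plane z w + b)"
    proof (rule exI[of _ 640], rule exI[of _ 200000], intro conjI ballI)
      fix z w
      assume zw: "z \<in> mspace hyperbolic_plane" "w \<in> mspace hyperbolic_plane"
      then have z: "0 < Im z" and w: "0 < Im w"
        by (simp_all add: upper_half_plane_def)
      \<comment> \<open>The angle of \<open>w\<close> is changed by an integer to bring it within \<open>1 / 2\<close> of that of \<open>z\<close>.\<close>
      define t where "t = round (X z - X w)"
      define y where "y = X w + of_int t"
      have xy: "\<bar>X z - y\<bar> \<le> 1 / 2"
        using of_int_round_abs_le[of "X z - X w"]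
        by (simp add: y_def t_def abs_minus_commute algebra_simps)
      have w': "polar w (R w) y"
        using polar_shift[OF polar[OF w]] by (simp add: y_def)
      have "mdist (l1_prod_metric binary_tree binary_tree) (f z) (f w) =
          real (word_dist (address (X z) (k z)) (address y (k w)) +
          word_dist (address (X z + 1 / 2) (k z)) (address (y + 1 / 2) (k w)))"
        using expansion_periodic[of "X w" t] expansion_periodic[of "X w + 1 / 2" t]
        by (simp add: f_def tree_dist_vertex y_def address_def algebra_simps)
      note bounds = hyp_dist_address_pair_dist[OF z polar[OF z] w w' k[OF z] k[OF w] xy this]
      show "mdist hyperbolic_plane z w / 640 - 200000 \<le>
          mdist (l1_prod_metric binary_tree binary_tree) (f z) (f w)"
        "mdist (l1_prod_metric binary_tree binary_tree) (f z) (f w) \<le>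
          640 * mdist hyperbolic_plane z w + 200000"
        using bounds zw by simp_all
    qed simp_all
  qed
  then show ?thesis
    by blast
qed

end
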